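(* Let $\mathcal{G}$ be a metric graph obtained from a compact core $\mathcal{K}$ by attaching $N\ge1$ half-lines, as described in the context, and let $\mu>0$. Then for every $p\in(2,4)$ the minimum $$\min_{u\in H^1_\mu(\mathcal{G})}E(u,\mathcal{G})$$ is attained, i.e. there exists $u\in H^1_\mu(\mathcal{G})$ with $E(u,\mathcal{G})=\inf_{v\in H^1_\mu(\mathcal{G})}E(v,\mathcal{G})$.
   Context: Graphs are multigraphs (multiple edges and self-loops are allowed, and there is no constraint on the degree of the vertices). A metric graph is a connected graph in which each edge $e$ of length $l_e$ is identified with an interval $I_e=[0,l_e]$ if $l_e<\infty$, and with $I_e=[0,+\infty)$ if $l_e=+\infty$; in the latter case $e$ is called a half-line and $x_e=0$ is its starting point. Let $\mathcal{K}=(\mathrm{V}_{\mathcal{K}},\mathrm{E}_{\mathcal{K}})$ be a nontrivial compact connected metric graph, i.e. one with finitely many vertices and edges, at least one edge, and all edges of finite positive length (no half-lines). Let $\mathcal{R}_1,\dots,\mathcal{R}_N$, $N\ge1$, be half-lines, each starting from a vertex of $\mathcal{K}$ (the starting vertices need not be distinct) and ending at distinct vertices at infinity. The graph $\mathcal{G}$ has vertices those of $\mathcal{K}$ together with the $N$ vertices at infinity, and edges $\mathrm{E}=\mathrm{E}_{\mathcal{K}}\cup\{\mathcal{R}_1,\dots,\mathcal{R}_N\}$. A function $u:\mathcal{G}\to\mathbb{R}$ is a family $(u_e)_{e\in\mathrm{E}}$ with $u_e:I_e\to\mathbb{R}$. One sets $\|u\|_{L^q(\mathcal{G})}^q=\sum_{e\in\mathrm{E}}\|u_e\|_{L^q(I_e)}^q$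 and $\|u\|_{L^q(\mathcal{K})}^q=\sum_{e\in\mathrm{E}_{\mathcal{K}}}\|u_e\|_{L^q(I_e)}^q$. The space $H^1(\mathcal{G})$ consists of the functions $u=(u_e)_{e\in\mathrm{E}}$ that are continuous on $\mathcal{G}$ (in particular at the vertices of $\mathcal{K}$) and satisfy $u_e\in H^1(I_e)$ for every $e\in\mathrm{E}$. For $\mu>0$, $H^1_\mu(\mathcal{G})=\{u\in H^1(\mathcal{G}):\|u\|_{L^2(\mathcal{G})}^2=\mu\}$. The energy functional is $$E(u,\mathcal{G})=\tfrac12\|u'\|_{L^2(\mathcal{G})}^2-\tfrac1p\|u\|_{L^p(\mathcal{K})}^p=\tfrac12\sum_{e\in\mathrm{E}}\int_{I_e}|u_e'|^2\,dx_e-\tfrac1p\sum_{e\in\mathrm{E}_{\mathcal{K}}}\int_{I_e}|u_e|^p\,dx_e .$$ *)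

theory Defs
  imports "Graph_Theory.Digraph_Component" "HOL-Analysis.Analysis"
begin

section \<open>Metric graphs\<close>

text \<open>
  The multigraph underlying a metric graph is a \<^typ>\<open>('v, 'e) pre_digraph\<close>, in which parallel
  arcs and loops are allowed. The orientation of an arc only records the parametrization of the
  edge: the coordinate \<open>0\<close> is at the tail and, if the edge has finite length, the coordinate
  \<open>len\<close> is at the head. A half-line is an edge of length \<open>\<infinity>\<close>; its head is a vertex at infinity.
\<close>

record ('v, 'e) metric_graph =
  graph :: "('v, 'e) pre_digraph"
  len :: "'e \<Rightarrow> ereal"

abbreviation edges :: "('v, 'e) metric_graph \<Rightarrow> 'e set" where
  "edges G \<equiv> arcs (graph G)"

definition interval :: "('v, 'e) metric_graph \<Rightarrow> 'e \<Rightarrow> real set" where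
  "interval G e = {x. 0 \<le> x \<and> ereal x \<le> len G e}"

definition compact_metric_graph :: "('v, 'e) metric_graph \<Rightarrow> bool" where
  "compact_metric_graph K \<longleftrightarrow>
     fin_digraph (graph K) \<and> Digraph_Component.connected (graph K) \<and>
     (\<forall>e\<in>edges K. 0 < len K e \<and> len K e < \<infinity>)"

text \<open>
  Attaching to \<open>K\<close> the half-lines \<open>Inr 0, \<dots>, Inr (N - 1)\<close>, where the \<open>i\<close>-th one starts at the
  vertex \<open>s i\<close> of \<open>K\<close> and ends at its own vertex at infinity \<open>Inr i\<close>.
\<close>

definition attach_half_lines ::
  "('v, 'e) metric_graph \<Rightarrow> nat \<Rightarrow> (nat \<Rightarrow> 'v) \<Rightarrow> ('v + nat, 'e + nat) metric_graph" where
  "attach_half_lines K N s =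
     \<lparr>graph =
        \<lparr>verts = Inl ` verts (graph K) \<union> Inr ` {..<N},
         arcs = Inl ` edges K \<union> Inr ` {..<N},
         tail = case_sum (\<lambda>e. Inl (tail (graph K) e)) (\<lambda>i. Inl (s i)),
         head = case_sum (\<lambda>e. Inl (head (graph K) e)) (\<lambda>i. Inr i)\<rparr>,
      len = case_sum (len K) (\<lambda>i. \<infinity>)\<rparr>"


section \<open>Lebesgue and Sobolev spaces on an interval\<close>

definition Lq_on :: "real \<Rightarrow> real set \<Rightarrow> (real \<Rightarrow> real) set" where
  "Lq_on q I = {f. set_borel_measurable lebesgue I f \<and>
                   set_integrable lebesgue I (\<lambda>x. \<bar>f x\<bar> powr q)}"

text \<open>
  \<open>H\<^sup>1(I)\<close> is the space of all \<open>f \<in> L\<^sup>2(I)\<close> that have a weak derivative in \<open>L\<^sup>2(I)\<close>. As in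
  Brezis' textbook (Chapter 8), the test functions are the \<open>C\<^sup>1\<close> functions with compact support
  in the interior of \<open>I\<close>.
\<close>

definition test_function :: "real set \<Rightarrow> (real \<Rightarrow> real) \<Rightarrow> bool" where
  "test_function I \<phi> \<longleftrightarrow> \<phi> C1_differentiable_on UNIV \<and>
     (\<exists>C. compact C \<and> C \<subseteq> interior I \<and> (\<forall>x. x \<notin> C \<longrightarrow> \<phi> x = 0))"

definition has_weak_deriv :: "real set \<Rightarrow> (real \<Rightarrow> real) \<Rightarrow> (real \<Rightarrow> real) \<Rightarrow> bool" where
  "has_weak_deriv I f g \<longleftrightarrow> (\<forall>\<phi>. test_function I \<phi> \<longrightarrow>
     (LINT x:I|lebesgue. f x * deriv \<phi> x) = - (LINT x:I|lebesgue. g x * \<phi> x))"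

definition H1_on :: "real set \<Rightarrow> (real \<Rightarrow> real) set" where
  "H1_on I = {f \<in> Lq_on 2 I. \<exists>g \<in> Lq_on 2 I. has_weak_deriv I f g}"

text \<open>
  The weak derivative is unique only up to null sets, hence a choice is made; integrals of it do
  not depend on this choice. The value is meaningful only for \<open>f \<in> H1_on I\<close>.
\<close>

definition weak_deriv :: "real set \<Rightarrow> (real \<Rightarrow> real) \<Rightarrow> real \<Rightarrow> real" where
  "weak_deriv I f = (SOME g. g \<in> Lq_on 2 I \<and> has_weak_deriv I f g)"


section \<open>Functions on a metric graph\<close>

text \<open>
  A function on \<open>G\<close> is a family \<open>u\<close> of functions indexed by the edges; the values of \<open>u e\<close> are
  relevant only for \<open>e \<in> edges G\<close> and on \<open>interval G e\<close>.
  Continuity means continuity along each edge together with the existence, at each vertex, of a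
  common value \<open>c v\<close> of all the edges incident with it. Nothing is required at a vertex at
  infinity, as the interval of a half-line is \<open>[0, \<infinity>)\<close>.
\<close>

definition continuous_on_graph ::
  "('v, 'e) metric_graph \<Rightarrow> ('e \<Rightarrow> real \<Rightarrow> real) \<Rightarrow> bool" where
  "continuous_on_graph G u \<longleftrightarrow>
     (\<forall>e\<in>edges G. continuous_on (interval G e) (u e)) \<and>
     (\<exists>c. \<forall>e\<in>edges G. u e 0 = c (tail (graph G) e) \<and>
        (len G e < \<infinity> \<longrightarrow> u e (real_of_ereal (len G e)) = c (head (graph G) e)))"

definition H1 :: "('v, 'e) metric_graph \<Rightarrow> ('e \<Rightarrow> real \<Rightarrow> real) set" where
  "H1 G = {u. continuous_on_graph G u \<and> (\<forall>e\<in>edges G. u e \<in> H1_on (interval G e))}"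

text \<open>The \<open>q\<close>-th power of the norm of \<open>L\<^sup>q(G)\<close>.\<close>

definition Lq_norm_pow ::
  "real \<Rightarrow> ('v, 'e) metric_graph \<Rightarrow> ('e \<Rightarrow> real \<Rightarrow> real) \<Rightarrow> real" where
  "Lq_norm_pow q G u = (\<Sum>e\<in>edges G. LINT x:interval G e|lebesgue. \<bar>u e x\<bar> powr q)"

definition H1_mass :: "real \<Rightarrow> ('v, 'e) metric_graph \<Rightarrow> ('e \<Rightarrow> real \<Rightarrow> real) set" where
  "H1_mass \<mu> G = {u \<in> H1 G. Lq_norm_pow 2 G u = \<mu>}"

definition graph_deriv ::
  "('v, 'e) metric_graph \<Rightarrow> ('e \<Rightarrow> real \<Rightarrow> real) \<Rightarrow> 'e \<Rightarrow> real \<Rightarrow> real" where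
  "graph_deriv G u e = weak_deriv (interval G e) (u e)"

text \<open>
  The energy on the graph \<open>attach_half_lines K N s\<close>; the nonlinear term only involves
  \<open>\<lambda>e. u (Inl e)\<close>, the restriction of \<open>u\<close> to \<open>K\<close>.
\<close>

definition energy ::
  "real \<Rightarrow> ('v, 'e) metric_graph \<Rightarrow> nat \<Rightarrow> (nat \<Rightarrow> 'v) \<Rightarrow> ('e + nat \<Rightarrow> real \<Rightarrow> real) \<Rightarrow> real" where
  "energy p K N s u =
     1 / 2 * Lq_norm_pow 2 (attach_half_lines K N s) (graph_deriv (attach_half_lines K N s) u)
     - 1 / p * Lq_norm_pow p K (\<lambda>e. u (Inl e))"

end

theory Submission
  imports Defs "HOL-Complex_Analysis.Great_Picard"
begin

text \<open>
Write \<open>D u\<close> for the squared \<open>L\<^sup>2\<close> norm of the derivative, \<open>F u\<close> for the \<open>p\<close>-th power of the \<open>L\<^sup>p\<close>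
norm on the compact core, and \<open>I\<close> for the infimum of \<open>E = D / 2 - F / p\<close> over the functions of mass
\<open>\<mu>\<close>. The infimum is attained for the following reasons.

The energy is coercive: on a core edge the supremum of \<open>u\<^sup>2\<close> is bounded by the mass and \<open>D u\<close>, so
for bounded mass \<open>F u\<close> grows at most like the power \<open>(p - 2) / 2 < 1\<close> of \<open>D u\<close> (lemma \<open>coercive\<close>). Moreover
\<open>I < 0\<close>: a function that equals a small constant on the core and decays slowly along the half-lines has
small mass and, since \<open>p < 4\<close>, negative energy (lemma \<open>negative_energy\<close>).

Because \<open>I < 0\<close>, mass that escapes to infinity does no harm. Multiplying a function of negative energy
by a constant \<open>c \<ge> 1\<close> multiplies \<open>D\<close> by \<open>c\<^sup>2\<close> and \<open>F\<close> by \<open>c\<^sup>p \<ge> c\<^sup>2\<close>, so the energy does not increase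
when the mass is restored to \<open>\<mu>\<close> (lemma \<open>scale_to_mass\<close>). Hence \<open>I\<close> is also a lower bound for
the energy on the convex set of functions of mass at most \<open>\<mu>\<close>, and a minimizer on that set yields one
of mass exactly \<open>\<mu>\<close>.

On the convex set a midpoint argument gives strong convergence of the derivatives. By the Arzela-Ascoli
theorem a minimizing sequence \<open>u\<^sub>n\<close> may be assumed to converge uniformly on the core, so \<open>F\<close> takes nearly equal
values at \<open>u\<^sub>n\<close>, at \<open>u\<^sub>m\<close> and at their midpoint \<open>w\<close>. The parallelogram identity gives
\<open>D (u\<^sub>n - u\<^sub>m) / 4 = E u\<^sub>n + E u\<^sub>m - 2 E w + (F u\<^sub>n + F u\<^sub>m - 2 F w) / p\<close>, and \<open>E w \<ge> I\<close>; so the derivatives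
form a Cauchy sequence in \<open>L\<^sup>2\<close> (lemma \<open>minimizing_sequence_dirichlet_Cauchy\<close>). Their strong limit
is the derivative of the pointwise limit of the functions (lemma \<open>H1_limit\<close>), which therefore has
energy \<open>I\<close>; its mass is at most \<open>\<mu>\<close> by Fatou's lemma.

The one-dimensional input is the fundamental theorem of calculus for weak derivatives of continuous
functions, obtained by testing with smoothed indicator functions of intervals
(lemma \<open>weak_deriv_FTC_interior\<close>). It yields the Hoelder estimate used throughout and the uniqueness of
weak derivatives, which makes \<open>D\<close> computable.
\<close>

section \<open>Square integrable functions\<close>

definition sq_integrable :: "'a measure \<Rightarrow> ('a \<Rightarrow> real) \<Rightarrow> bool" where
  "sq_integrable M f \<longleftrightarrow> f \<in> borel_measurable M \<and> integrable M (\<lambda>x. (f x)\<^sup>2)"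

lemma sq_integrableD:
  assumes "sq_integrable M f"
  shows "f \<in> borel_measurable M" "integrable M (\<lambda>x. (f x)\<^sup>2)"
  using assms by (auto simp: sq_integrable_def)

lemma sq_integrable_mult:
  assumes f: "sq_integrable M f" and g: "sq_integrable M g"
  shows "integrable M (\<lambda>x. f x * g x)"
proof (rule Bochner_Integration.integrable_bound)
  note [measurable] = sq_integrableD(1)[OF f] sq_integrableD(1)[OF g]
  show "integrable M (\<lambda>x. (f x)\<^sup>2 + (g x)\<^sup>2)"
    using sq_integrableD(2)[OF f] sq_integrableD(2)[OF g] by (rule Bochner_Integration.integrable_add)
  show "(\<lambda>x. f x * g x) \<in> borel_measurable M"
    by measurable
  have "\<bar>a * b\<bar> \<le> a\<^sup>2 + b\<^sup>2" for a b :: real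
  proof -
    have "\<bar>a * b\<bar> * 2 \<le> \<bar>a\<bar>\<^sup>2 + \<bar>b\<bar>\<^sup>2"
      using sum_squares_bound[of "\<bar>a\<bar>" "\<bar>b\<bar>"] by (simp add: abs_mult ac_simps)
    then show ?thesis
      using zero_le_power2[of a] zero_le_power2[of b] unfolding power2_abs by linarith
  qed
  then show "AE x in M. norm (f x * g x) \<le> norm ((f x)\<^sup>2 + (g x)\<^sup>2)"
    by (intro AE_I2) simp
qed

lemma sq_integrable_cmult:
  assumes "sq_integrable M f" shows "sq_integrable M (\<lambda>x. c * f x)"
  using assms by (auto simp: sq_integrable_def power_mult_distrib)

lemma sq_integrable_abs:
  assumes "sq_integrable M f" shows "sq_integrable M (\<lambda>x. \<bar>f x\<bar>)"
  using assms by (auto simp: sq_integrable_def)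

lemma sq_integrable_add:
  assumes f: "sq_integrable M f" and g: "sq_integrable M g"
  shows "sq_integrable M (\<lambda>x. f x + g x)"
  using sq_integrable_mult[OF f g] assms
  by (auto simp: sq_integrable_def power2_sum mult.assoc)

lemma sq_integrable_diff:
  assumes f: "sq_integrable M f" and g: "sq_integrable M g"
  shows "sq_integrable M (\<lambda>x. f x - g x)"
  using sq_integrable_add[OF f sq_integrable_cmult[OF g, of "-1"]] by simp

lemma integral_square_lincomb:
  assumes f: "sq_integrable M f" and g: "sq_integrable M g"
  shows "(\<integral>x. (a * f x + b * g x)\<^sup>2 \<partial>M) =
    a\<^sup>2 * (\<integral>x. (f x)\<^sup>2 \<partial>M) + 2 * a * b * (\<integral>x. f x * g x \<partial>M) + b\<^sup>2 * (\<integral>x. (g x)\<^sup>2 \<partial>M)"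
proof -
  have "(\<lambda>x. (a * f x + b * g x)\<^sup>2) =
      (\<lambda>x. a\<^sup>2 * (f x)\<^sup>2 + 2 * a * b * (f x * g x) + b\<^sup>2 * (g x)\<^sup>2)"
    by (auto simp: power2_eq_square algebra_simps)
  then show ?thesis
    using sq_integrable_mult[OF f g] sq_integrableD(2)[OF f] sq_integrableD(2)[OF g]
    by (simp add: mult.assoc)
qed

text \<open>
The quadratic polynomial \<open>t \<mapsto> \<integral>(f + t g)\<^sup>2\<close> is nonnegative, so its discriminant is not positive.
\<close>

lemma Cauchy_Schwarz_integral:
  assumes f: "sq_integrable M f" and g: "sq_integrable M g"
  shows "(\<integral>x. f x * g x \<partial>M)\<^sup>2 \<le> (\<integral>x. (f x)\<^sup>2 \<partial>M) * (\<integral>x. (g x)\<^sup>2 \<partial>M)"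
proof -
  define a b c where "a = (\<integral>x. (f x)\<^sup>2 \<partial>M)" and "b = (\<integral>x. f x * g x \<partial>M)"
    and "c = (\<integral>x. (g x)\<^sup>2 \<partial>M)"
  have q: "0 \<le> a + 2 * t * b + t\<^sup>2 * c" for t
  proof -
    have "0 \<le> (\<integral>x. (1 * f x + t * g x)\<^sup>2 \<partial>M)"
      by (rule Bochner_Integration.integral_nonneg) simp
    then show ?thesis
      unfolding integral_square_lincomb[OF f g] by (simp add: a_def b_def c_def)
  qed
  have c0: "c \<ge> 0"
    unfolding c_def by simp
  have "b\<^sup>2 \<le> a * c"
  proof (cases "c = 0")
    case True
    then have "b = 0"
      using q[of "-(a + 1) / (2 * b)"] by (cases "b = 0") (auto simp: field_simps)
    with True show ?thesis by simp
  next
    case False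
    with c0 have "c > 0" by simp
    have "0 \<le> a - b\<^sup>2 / c"
      using q[of "- b / c"] \<open>c > 0\<close> by (simp add: field_simps power2_eq_square)
    then show ?thesis
      using \<open>c > 0\<close> by (simp add: field_simps)
  qed
  then show ?thesis
    by (simp add: a_def b_def c_def)
qed

lemma nn_integral_square_le_liminf:
  fixes f :: "nat \<Rightarrow> 'a \<Rightarrow> real"
  assumes [measurable]: "\<And>n. f n \<in> borel_measurable M"
    and lim: "AE x in M. (\<lambda>n. f n x) \<longlonglongrightarrow> g x"
  shows "(\<integral>\<^sup>+x. ennreal ((g x)\<^sup>2) \<partial>M) \<le> liminf (\<lambda>n. \<integral>\<^sup>+x. ennreal ((f n x)\<^sup>2) \<partial>M)"
proof -
  have "(\<integral>\<^sup>+x. ennreal ((g x)\<^sup>2) \<partial>M) = (\<integral>\<^sup>+x. liminf (\<lambda>n. ennreal ((f n x)\<^sup>2)) \<partial>M)"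
  proof (rule nn_integral_cong_AE, use lim in eventually_elim)
    case (elim x)
    then have "(\<lambda>n. ennreal ((f n x)\<^sup>2)) \<longlonglongrightarrow> ennreal ((g x)\<^sup>2)"
      by (intro tendsto_intros)
    from lim_imp_Liminf[OF trivial_limit_sequentially this] show ?case
      by (rule sym)
  qed
  also have "\<dots> \<le> liminf (\<lambda>n. \<integral>\<^sup>+x. ennreal ((f n x)\<^sup>2) \<partial>M)"
    by (rule nn_integral_liminf) measurable
  finally show ?thesis .
qed

lemma square_integral_Fatou:
  assumes f: "\<And>n. sq_integrable M (f n)" and g[measurable]: "g \<in> borel_measurable M"
    and lim: "AE x in M. (\<lambda>n. f n x) \<longlonglongrightarrow> g x"
    and B: "\<And>n::nat. (\<integral>x. (f n x)\<^sup>2 \<partial>M) \<le> B"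
  shows "sq_integrable M g" "(\<integral>x. (g x)\<^sup>2 \<partial>M) \<le> B"
proof -
  have B0: "B \<ge> 0"
    using B[of 0] by (rule order_trans[rotated]) simp
  have "(\<integral>\<^sup>+x. ennreal ((g x)\<^sup>2) \<partial>M) \<le> liminf (\<lambda>n. \<integral>\<^sup>+x. ennreal ((f n x)\<^sup>2) \<partial>M)"
    by (rule nn_integral_square_le_liminf[OF sq_integrableD(1)[OF f] lim])
  also have "\<dots> \<le> liminf (\<lambda>n. ennreal B)"
    using B by (intro Liminf_mono always_eventually allI)
      (simp add: nn_integral_eq_integral sq_integrableD(2)[OF f] ennreal_leI)
  finally have *: "(\<integral>\<^sup>+x. ennreal ((g x)\<^sup>2) \<partial>M) \<le> ennreal B"
    by (simp add: Liminf_const)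
  have i: "integrable M (\<lambda>x. (g x)\<^sup>2)"
  proof (rule integrableI_bounded)
    have "ennreal B < \<infinity>" by simp
    with * show "(\<integral>\<^sup>+x. ennreal (norm ((g x)\<^sup>2)) \<partial>M) < \<infinity>"
      by (simp add: le_less_trans)
  qed measurable
  then show "sq_integrable M g"
    by (simp add: sq_integrable_def)
  show "(\<integral>x. (g x)\<^sup>2 \<partial>M) \<le> B"
    using * B0 by (simp add: nn_integral_eq_integral[OF i])
qed

text \<open>
Lower semicontinuity in the form of a strict bound that holds eventually, so that the bounds on finitely
many edges hold simultaneously from some index on and can be added.
\<close>

lemma square_integral_lower_semicontinuous:
  assumes f: "\<And>n. sq_integrable M (f n)" and g: "sq_integrable M g"
    and lim: "AE x in M. (\<lambda>n. f n x) \<longlonglongrightarrow> g x"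
    and c: "c < (\<integral>x. (g x)\<^sup>2 \<partial>M)"
  shows "eventually (\<lambda>n. c < (\<integral>x. (f n x)\<^sup>2 \<partial>M)) sequentially"
proof (cases "c < 0")
  case True
  have "c < (\<integral>x. (f n x)\<^sup>2 \<partial>M)" for n
    by (rule less_le_trans[OF True]) simp
  then show ?thesis
    by (intro always_eventually allI)
next
  case False
  have "ennreal c < (\<integral>\<^sup>+x. ennreal ((g x)\<^sup>2) \<partial>M)"
    using c False by (simp add: nn_integral_eq_integral sq_integrableD(2)[OF g] ennreal_less_iff)
  also have "\<dots> \<le> liminf (\<lambda>n. \<integral>\<^sup>+x. ennreal ((f n x)\<^sup>2) \<partial>M)"
    by (rule nn_integral_square_le_liminf[OF sq_integrableD(1)[OF f] lim])
  finally have "eventually (\<lambda>n. ennreal c < (\<integral>\<^sup>+x. ennreal ((f n x)\<^sup>2) \<partial>M)) sequentially"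
    by (rule less_LiminfD)
  then show ?thesis
    using False by (simp add: nn_integral_eq_integral sq_integrableD(2)[OF f] ennreal_less_iff)
qed

lemma tendsto_square_integral:
  assumes f: "\<And>n. sq_integrable M (f n)" and g: "sq_integrable M g"
    and lim: "(\<lambda>n. \<integral>x. (f n x - g x)\<^sup>2 \<partial>M) \<longlonglongrightarrow> 0"
  shows "(\<lambda>n. \<integral>x. (f n x)\<^sup>2 \<partial>M) \<longlonglongrightarrow> (\<integral>x. (g x)\<^sup>2 \<partial>M)"
proof -
  define A where "A n = (\<integral>x. (f n x - g x)\<^sup>2 \<partial>M)" for n
  define B where "B n = (\<integral>x. (f n x - g x) * g x \<partial>M)" for n
  have eq: "(\<integral>x. (f n x)\<^sup>2 \<partial>M) = A n + 2 * B n + (\<integral>x. (g x)\<^sup>2 \<partial>M)" for n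
    using integral_square_lincomb[OF sq_integrable_diff[OF f g] g, of 1 n 1] by (simp add: A_def B_def)
  have "norm (B n) \<le> sqrt (A n) * sqrt (\<integral>x. (g x)\<^sup>2 \<partial>M)" for n
  proof -
    have "\<bar>B n\<bar> \<le> sqrt (A n * (\<integral>x. (g x)\<^sup>2 \<partial>M))"
      using Cauchy_Schwarz_integral[OF sq_integrable_diff[OF f g] g, of n]
      by (intro real_le_rsqrt) (simp add: A_def B_def)
    then show ?thesis
      by (simp add: real_sqrt_mult)
  qed
  then have le: "\<forall>\<^sub>F n in sequentially. norm (B n) \<le> sqrt (A n) * sqrt (\<integral>x. (g x)\<^sup>2 \<partial>M)"
    by (intro always_eventually allI)
  have "(\<lambda>n. sqrt (A n) * sqrt (\<integral>x. (g x)\<^sup>2 \<partial>M)) \<longlonglongrightarrow> sqrt 0 * sqrt (\<integral>x. (g x)\<^sup>2 \<partial>M)"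
    using lim unfolding A_def[symmetric] by (intro tendsto_intros)
  then have "B \<longlonglongrightarrow> 0"
    by (intro Lim_null_comparison[OF le]) simp
  moreover have "A \<longlonglongrightarrow> 0"
    using lim by (simp add: A_def[abs_def])
  ultimately have "(\<lambda>n. A n + 2 * B n + (\<integral>x. (g x)\<^sup>2 \<partial>M)) \<longlonglongrightarrow> 0 + 2 * 0 + (\<integral>x. (g x)\<^sup>2 \<partial>M)"
    by (intro tendsto_intros)
  then show ?thesis
    by (simp add: eq)
qed

text \<open>
The weighted sum \<open>\<Sum>n. 2\<^sup>n (g\<^sub>n\<^sub>+\<^sub>1 - g\<^sub>n)\<^sup>2\<close> has a finite integral, hence is finite almost everywhere. At
such a point the increments are dominated by a geometric sequence with ratio \<open>1 / sqrt 2\<close>.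
\<close>

lemma AE_convergent_if_rapidly_Cauchy:
  assumes g: "\<And>n. sq_integrable M (g n)"
    and le: "\<And>n. (\<integral>x. (g (Suc n) x - g n x)\<^sup>2 \<partial>M) \<le> (1/4) ^ n"
  shows "AE x in M. convergent (\<lambda>n. g n x)"
proof -
  define d where "d n x = g (Suc n) x - g n x" for n x
  have sd: "sq_integrable M (d n)" for n
    unfolding d_def by (intro sq_integrable_diff g)
  note [measurable] = sq_integrableD(1)[OF sd]
  have "(\<integral>\<^sup>+x. (\<Sum>n. ennreal (2 ^ n * (d n x)\<^sup>2)) \<partial>M) = (\<Sum>n. \<integral>\<^sup>+x. ennreal (2 ^ n * (d n x)\<^sup>2) \<partial>M)"
    by (rule nn_integral_suminf) measurable
  also have "\<dots> = (\<Sum>n. ennreal (2 ^ n * (\<integral>x. (d n x)\<^sup>2 \<partial>M)))"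
    by (subst nn_integral_eq_integral) (auto intro!: sq_integrableD(2)[OF sd])
  also have "\<dots> \<le> (\<Sum>n. ennreal ((1/2) ^ n))"
  proof (intro suminf_le allI summableI ennreal_leI)
    fix n
    have "2 ^ n * (\<integral>x. (d n x)\<^sup>2 \<partial>M) \<le> 2 ^ n * (1/4) ^ n"
      using le[of n] by (simp add: d_def)
    also have "\<dots> = (1/2) ^ n"
      by (simp flip: power_mult_distrib)
    finally show "2 ^ n * (\<integral>x. (d n x)\<^sup>2 \<partial>M) \<le> (1/2) ^ n" .
  qed
  also have "\<dots> < \<infinity>"
    by (subst suminf_ennreal2) (auto intro: summable_geometric)
  finally have "AE x in M. (\<Sum>n. ennreal (2 ^ n * (d n x)\<^sup>2)) \<noteq> \<infinity>"
    by (intro nn_integral_PInf_AE) auto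
  then show ?thesis
  proof eventually_elim
    case (elim x)
    then have "summable (\<lambda>n. 2 ^ n * (d n x)\<^sup>2)"
      by (intro summable_suminf_not_top) (auto simp: top_unique)
    then have "Bseq (\<lambda>n. 2 ^ n * (d n x)\<^sup>2)"
      by (intro convergent_imp_Bseq summable_LIMSEQ_zero[THEN convergentI])
    then obtain C where C: "C > 0" "\<And>n. 2 ^ n * (d n x)\<^sup>2 \<le> C"
      unfolding Bseq_def by (auto simp: abs_le_iff)
    have dC: "norm (d n x) \<le> sqrt C * (1 / sqrt 2) ^ n" for n
    proof -
      have "(d n x)\<^sup>2 \<le> C * (1/2) ^ n"
        using C(2)[of n] by (simp add: field_simps)
      then have "sqrt ((d n x)\<^sup>2) \<le> sqrt (C * (1/2) ^ n)"
        by (rule real_sqrt_le_mono)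
      then show ?thesis
        by (simp add: real_sqrt_mult real_sqrt_power[of "1/2"] real_sqrt_divide)
    qed
    have "summable (\<lambda>n. sqrt C * (1 / sqrt 2) ^ n)"
      by (intro summable_mult summable_geometric) simp
    then have "summable (\<lambda>n. d n x)"
      by (rule summable_comparison_test') (rule dC)
    then have "convergent (\<lambda>n. \<Sum>k<n. d k x)"
      by (simp add: summable_iff_convergent)
    then have "convergent (\<lambda>n. (\<Sum>k<n. d k x) + g 0 x)"
      by (rule convergent_add[OF _ convergent_const])
    then show ?case
      by (simp add: d_def sum_lessThan_telescope[of "\<lambda>n. g n x"])
  qed
qed

lemma Riesz_Fischer_rapidly_Cauchy:
  assumes g: "\<And>n. sq_integrable M (g n)"
    and le: "\<And>n m. n \<le> m \<Longrightarrow> (\<integral>x. (g m x - g n x)\<^sup>2 \<partial>M) \<le> (1/4) ^ n"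
  obtains h where "sq_integrable M h" "AE x in M. (\<lambda>n. g n x) \<longlonglongrightarrow> h x"
    "(\<lambda>n. \<integral>x. (g n x - h x)\<^sup>2 \<partial>M) \<longlonglongrightarrow> 0"
proof -
  define h where "h x = lim (\<lambda>n. g n x)" for x
  note [measurable] = sq_integrableD(1)[OF g]
  have h[measurable]: "h \<in> borel_measurable M"
    unfolding h_def by (rule borel_measurable_lim_metric) measurable
  have "AE x in M. convergent (\<lambda>n. g n x)"
    using le by (intro AE_convergent_if_rapidly_Cauchy g) auto
  then have lim: "AE x in M. (\<lambda>n. g n x) \<longlonglongrightarrow> h x"
    by eventually_elim (simp add: h_def convergent_LIMSEQ_iff)
  have d: "sq_integrable M (\<lambda>x. g n x - h x)" "(\<integral>x. (g n x - h x)\<^sup>2 \<partial>M) \<le> (1/4) ^ n" for n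
  proof -
    have 1: "sq_integrable M (\<lambda>x. g n x - g (n + k) x)" for k
      by (intro sq_integrable_diff g)
    have 2: "(\<lambda>x. g n x - h x) \<in> borel_measurable M"
      by measurable
    have 3: "AE x in M. (\<lambda>k. g n x - g (n + k) x) \<longlonglongrightarrow> g n x - h x"
      using lim
    proof eventually_elim
      case (elim x)
      then show ?case
        using LIMSEQ_ignore_initial_segment[of "\<lambda>n. g n x" "h x" n]
        by (intro tendsto_diff tendsto_const) (simp add: add.commute)
    qed
    have 4: "(\<integral>x. (g n x - g (n + k) x)\<^sup>2 \<partial>M) \<le> (1/4) ^ n" for k
      using le[of n "n + k"] by (simp add: power2_commute)
    show "sq_integrable M (\<lambda>x. g n x - h x)" "(\<integral>x. (g n x - h x)\<^sup>2 \<partial>M) \<le> (1/4) ^ n"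
      using square_integral_Fatou[where f = "\<lambda>k x. g n x - g (n + k) x", OF 1 2 3 4] by auto
  qed
  have "sq_integrable M h"
    using sq_integrable_diff[OF g d(1), of 0 0] by simp
  moreover have "(\<lambda>n. \<integral>x. (g n x - h x)\<^sup>2 \<partial>M) \<longlonglongrightarrow> 0"
    by (rule tendsto_sandwich[of "\<lambda>_. 0" _ _ "\<lambda>n. (1/4) ^ n"])
      (auto intro!: always_eventually d(2) LIMSEQ_realpow_zero)
  ultimately show thesis
    using that lim by blast
qed

section \<open>Smoothed indicator functions\<close>

text \<open>
Cubic interpolation between \<open>0\<close> on the negative axis and \<open>1\<close> beyond \<open>1\<close>. Differences of its translates
and dilations are \<open>C\<^sup>1\<close> approximations of indicator functions of intervals.
\<close>

definition smooth_step :: "real \<Rightarrow> real" where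
  "smooth_step t = (let s = max 0 (min 1 t) in s\<^sup>2 * (3 - 2 * s))"

text \<open>
The derivative of the smooth step, a nonnegative kernel of total mass \<open>1\<close> supported in the unit interval.
\<close>

definition bump :: "real \<Rightarrow> real" where
  "bump t = (let s = max 0 (min 1 t) in 6 * s * (1 - s))"

lemma smooth_step_eq_0: "t \<le> 0 \<Longrightarrow> smooth_step t = 0"
  and smooth_step_eq_1: "t \<ge> 1 \<Longrightarrow> smooth_step t = 1"
  and bump_eq_0: "t \<le> 0 \<or> t \<ge> 1 \<Longrightarrow> bump t = 0"
  and bump_nonneg: "bump t \<ge> 0"
proof -
  show "t \<le> 0 \<Longrightarrow> smooth_step t = 0" "t \<ge> 1 \<Longrightarrow> smooth_step t = 1"
    "t \<le> 0 \<or> t \<ge> 1 \<Longrightarrow> bump t = 0"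
    unfolding smooth_step_def bump_def Let_def by auto
  define s where "s = max 0 (min 1 t)"
  have "0 \<le> s" "s \<le> 1"
    by (auto simp: s_def)
  then show "bump t \<ge> 0"
    unfolding bump_def Let_def s_def[symmetric] by simp
qed

lemma smooth_step_bounds: "0 \<le> smooth_step t" "smooth_step t \<le> 1"
proof -
  define s where "s = max 0 (min 1 t)"
  have s: "0 \<le> s" "s \<le> 1"
    by (auto simp: s_def)
  then show "0 \<le> smooth_step t"
    by (simp add: smooth_step_def Let_def flip: s_def)
  have "1 - s\<^sup>2 * (3 - 2 * s) = (1 - s)\<^sup>2 * (1 + 2 * s)"
    by (simp add: power2_eq_square algebra_simps)
  also have "\<dots> \<ge> 0"
    using s by simp
  finally show "smooth_step t \<le> 1"
    by (simp add: smooth_step_def Let_def flip: s_def)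
qed

lemma continuous_on_bump [continuous_intros]: 
  "continuous_on A f \<Longrightarrow> continuous_on A (\<lambda>x. bump (f x))"
  unfolding bump_def Let_def by (intro continuous_intros)

text \<open>
The cubic polynomial is glued to the constants at \<open>1\<close> and at \<open>0\<close>, where values and derivatives agree.
\<close>

lemma has_real_derivative_smooth_step: "(smooth_step has_real_derivative bump t) (at t)"
proof -
  define P Q :: "real \<Rightarrow> real" where "P t = t\<^sup>2 * (3 - 2 * t)" and "Q t = 6 * t * (1 - t)" for t
  define P1 Q1 where "P1 t = (if t \<in> {..1} then P t else 1)" 
    and "Q1 t = (if t \<in> {..1} then Q t else 0)" for t
  have P: "(P has_vector_derivative Q t) (at t within A)" for t A
    unfolding P_def[abs_def] Q_def has_real_derivative_iff_has_vector_derivative[symmetric]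
    by (auto intro!: derivative_eq_intros simp: power2_eq_square algebra_simps)
  have const: "((\<lambda>_. c :: real) has_vector_derivative 0) (at t within A)" for c t A
    by (rule has_vector_derivative_const)
  have vals: "P 0 = 0" "P 1 = 1" "Q 0 = 0" "Q 1 = 0"
    by (auto simp: P_def Q_def)
  have P1: "(P1 has_vector_derivative Q1 t) (at t)" for t
    unfolding P1_def Q1_def
  proof (rule has_vector_derivative_If_within_closures[where T = "{1..}"])
    show "t \<in> {..1} \<union> {1..}" "(UNIV :: real set) = {..1} \<union> {1..}"
      by auto
    show "P t = 1" "Q t = 0" if "t \<in> closure {..1}" "t \<in> closure {1..}"
      using that vals by (auto simp: order_antisym_conv)
  qed (rule P const)+
  have "((\<lambda>t. if t \<in> {..0} then 0 else P1 t) has_vector_derivative (if t \<in> {..0} then 0 else Q1 t)) (at t)"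
  proof (rule has_vector_derivative_If_within_closures[where T = "{0..}"])
    show "t \<in> {..0} \<union> {0..}" "(UNIV :: real set) = {..0} \<union> {0..}"
      by auto
    show "0 = P1 t" "0 = Q1 t" if "t \<in> closure {..0}" "t \<in> closure {0..}"
      using that vals by (auto simp: order_antisym_conv P1_def Q1_def)
  qed (rule has_vector_derivative_at_within[OF P1] const)+
  moreover have "(\<lambda>t. if t \<in> {..0} then 0 else P1 t) = smooth_step"
    by (auto simp: P1_def P_def fun_eq_iff smooth_step_def Let_def)
  moreover have "(if t \<in> {..0} then 0 else Q1 t) = bump t"
    by (auto simp: Q1_def Q_def bump_def Let_def)
  ultimately show ?thesis
    by (simp add: has_real_derivative_iff_has_vector_derivative)
qed

section \<open>Weak derivatives on an interval\<close>

text \<open>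
This covers both kinds of edges: \<open>[0, l]\<close> with \<open>l > 0\<close> and \<open>[0, \<infinity>)\<close>.
\<close>

locale closed_interval =
  fixes I :: "real set"
  assumes closed: "closed I" and convex: "convex I" and interior_nonempty: "interior I \<noteq> {}"
begin

lemma sets_lebesgue [measurable, simp]: "I \<in> sets lebesgue"
  using closed by (simp add: borel_closed)

lemma Icc_subset_interior: "x \<in> interior I \<Longrightarrow> y \<in> interior I \<Longrightarrow> {x..y} \<subseteq> interior I"
  using convex_interior[OF convex] mem_is_interval_1_I[of "interior I" x y]
  by (auto simp: is_interval_convex_1)

lemma Lq_on_2_iff: "f \<in> Lq_on 2 I \<longleftrightarrow> sq_integrable (lebesgue_on I) f"
  by (simp add: Lq_on_def sq_integrable_def set_borel_measurable_def set_integrable_def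
      borel_measurable_restrict_space_iff integrable_restrict_space)

lemma set_integral_eq: "(LINT x:I|lebesgue. f x) = (\<integral>x. (f x :: real) \<partial>lebesgue_on I)"
  by (simp add: set_lebesgue_integral_def integral_restrict_space)

lemma has_weak_deriv_iff:
  "has_weak_deriv I f g \<longleftrightarrow> (\<forall>\<phi>. test_function I \<phi> \<longrightarrow>
     (\<integral>x. f x * deriv \<phi> x \<partial>lebesgue_on I) = - (\<integral>x. g x * \<phi> x \<partial>lebesgue_on I))"
  by (simp add: has_weak_deriv_def set_integral_eq)

lemma integrable_compact_support:
  fixes f :: "real \<Rightarrow> real"
  assumes f: "continuous_on UNIV f" and C: "compact C" "C \<subseteq> I" "\<And>x. x \<notin> C \<Longrightarrow> f x = 0"
  shows "integrable (lebesgue_on I) f"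
proof -
  have "integrable lborel (\<lambda>x. indicator C x * f x)"
    using borel_integrable_compact[OF C(1) continuous_on_subset[OF f]] by simp
  moreover have "(\<lambda>x. indicator C x * f x) = f"
    using C(3) by (auto simp: fun_eq_iff indicator_def)
  ultimately have "integrable lebesgue f"
    using borel_measurable_continuous_onI[OF f] by (simp add: integrable_completion)
  moreover have "(\<lambda>x. indicator I x * f x) = f"
    using C(2,3) by (auto simp: fun_eq_iff indicator_def)
  ultimately show ?thesis
    by (simp add: integrable_restrict_space)
qed

lemma sq_integrable_compact_support:
  fixes f :: "real \<Rightarrow> real"
  assumes "continuous_on UNIV f" "compact C" "C \<subseteq> I" "\<And>x. x \<notin> C \<Longrightarrow> f x = 0"
  shows "sq_integrable (lebesgue_on I) f"
  using integrable_compact_support[OF assms] integrable_compact_support[of "\<lambda>x. (f x)\<^sup>2" C] assms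
  by (auto simp: sq_integrable_def intro!: continuous_intros)

lemma test_functionE:
  assumes "test_function I \<phi>"
  obtains C where "compact C" "C \<subseteq> interior I"
    "\<And>x. x \<notin> C \<Longrightarrow> \<phi> x = 0" "\<And>x. x \<notin> C \<Longrightarrow> deriv \<phi> x = 0"
    "\<And>x. (\<phi> has_real_derivative deriv \<phi> x) (at x)"
    "continuous_on UNIV \<phi>" "continuous_on UNIV (deriv \<phi>)"
proof -
  from assms obtain D C where D: "\<And>x. (\<phi> has_vector_derivative D x) (at x)" "continuous_on UNIV D"
    and C: "compact C" "C \<subseteq> interior I" "\<And>x. x \<notin> C \<Longrightarrow> \<phi> x = 0"
    unfolding test_function_def C1_differentiable_on_def by blast
  have DD: "deriv \<phi> = D"
    using D(1) by (intro ext DERIV_imp_deriv) (simp add: has_real_derivative_iff_has_vector_derivative)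
  have "deriv \<phi> x = 0" if "x \<notin> C" for x
  proof -
    have "eventually (\<lambda>y. y \<in> - C) (nhds x)"
      using that C(1) by (intro eventually_nhds_in_open) (auto simp: compact_imp_closed)
    then have "eventually (\<lambda>y. \<phi> y = 0) (nhds x)"
      by eventually_elim (auto intro: C(3))
    then have "deriv \<phi> x = deriv (\<lambda>_. 0) x"
      by (intro deriv_cong_ev) auto
    then show ?thesis
      by simp
  qed
  moreover have "continuous_on UNIV \<phi>"
    using D(1) by (intro continuous_at_imp_continuous_on) (auto intro: has_vector_derivative_continuous)
  moreover have "continuous_on UNIV (deriv \<phi>)"
    using D(2) DD by simp
  ultimately show thesis
    using that C D(1) DD by (simp add: has_real_derivative_iff_has_vector_derivative)
qed

lemma test_function_sq_integrable:
  assumes "test_function I \<phi>"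
  shows "sq_integrable (lebesgue_on I) \<phi>" "sq_integrable (lebesgue_on I) (deriv \<phi>)"
proof -
  obtain C where C: "compact C" "C \<subseteq> interior I"
    "\<And>x. x \<notin> C \<Longrightarrow> \<phi> x = 0" "\<And>x. x \<notin> C \<Longrightarrow> deriv \<phi> x = 0"
    "continuous_on UNIV \<phi>" "continuous_on UNIV (deriv \<phi>)"
    using test_functionE[OF assms] by metis
  moreover have "C \<subseteq> I"
    using C(2) interior_subset by blast
  ultimately show "sq_integrable (lebesgue_on I) \<phi>" "sq_integrable (lebesgue_on I) (deriv \<phi>)"
    by (auto intro: sq_integrable_compact_support)
qed

lemma sq_integrable_indicator:
  assumes "A \<in> sets lebesgue" "emeasure lebesgue A < \<infinity>"
  shows "sq_integrable (lebesgue_on I) (indicator A)"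
proof -
  have "integrable lebesgue (indicator (I \<inter> A) :: real \<Rightarrow> real)"
    using assms emeasure_mono[of "I \<inter> A" A lebesgue] by (auto intro!: integrable_real_indicator le_less_trans)
  also have "(indicator (I \<inter> A) :: real \<Rightarrow> real) = (\<lambda>x. indicator I x * (indicator A x)\<^sup>2)"
    by (auto simp: indicator_def)
  finally show ?thesis
    using borel_measurable_indicator[OF assms(1), THEN measurable_restrict_space1]
    by (simp add: sq_integrable_def integrable_restrict_space)
qed

lemma sq_integrable_indicator_Ioc: "sq_integrable (lebesgue_on I) (indicator {a<..b})"
  and sq_integrable_indicator_Icc: "sq_integrable (lebesgue_on I) (indicator {a..b})"
proof -
  show "sq_integrable (lebesgue_on I) (indicator {a<..b})"
    by (cases "a \<le> b") (auto intro!: sq_integrable_indicator)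
  show "sq_integrable (lebesgue_on I) (indicator {a..b})"
    by (cases "a \<le> b") (auto intro!: sq_integrable_indicator)
qed

lemma has_weak_deriv_lincomb:
  assumes f: "sq_integrable (lebesgue_on I) f1" "sq_integrable (lebesgue_on I) f2"
    and g: "sq_integrable (lebesgue_on I) g1" "sq_integrable (lebesgue_on I) g2"
    and "has_weak_deriv I f1 g1" "has_weak_deriv I f2 g2"
  shows "has_weak_deriv I (\<lambda>x. a * f1 x + b * f2 x) (\<lambda>x. a * g1 x + b * g2 x)"
  unfolding has_weak_deriv_iff
proof (intro allI impI)
  fix \<phi> assume \<phi>: "test_function I \<phi>"
  note t = test_function_sq_integrable[OF \<phi>]
  have "(\<integral>x. (a * f1 x + b * f2 x) * deriv \<phi> x \<partial>lebesgue_on I) =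
      a * (\<integral>x. f1 x * deriv \<phi> x \<partial>lebesgue_on I) + b * (\<integral>x. f2 x * deriv \<phi> x \<partial>lebesgue_on I)"
    by (simp add: distrib_right mult.assoc sq_integrable_mult[OF f(1) t(2)] sq_integrable_mult[OF f(2) t(2)])
  moreover have "(\<integral>x. (a * g1 x + b * g2 x) * \<phi> x \<partial>lebesgue_on I) =
      a * (\<integral>x. g1 x * \<phi> x \<partial>lebesgue_on I) + b * (\<integral>x. g2 x * \<phi> x \<partial>lebesgue_on I)"
    by (simp add: distrib_right mult.assoc sq_integrable_mult[OF g(1) t(1)] sq_integrable_mult[OF g(2) t(1)])
  ultimately show "(\<integral>x. (a * f1 x + b * f2 x) * deriv \<phi> x \<partial>lebesgue_on I) =
      - (\<integral>x. (a * g1 x + b * g2 x) * \<phi> x \<partial>lebesgue_on I)"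
    using assms(5,6) \<phi> by (simp add: has_weak_deriv_iff)
qed

text \<open>
Both sides of the defining identity pass to the limit, since a test function has compact support: the left
one by dominated convergence, the right one by the Cauchy-Schwarz inequality.
\<close>

lemma has_weak_deriv_limit:
  assumes f: "\<And>n. sq_integrable (lebesgue_on I) (f n)" and g: "\<And>n. sq_integrable (lebesgue_on I) (g n)"
    and wd: "\<And>n. has_weak_deriv I (f n) (g n)"
    and f': "f' \<in> borel_measurable (lebesgue_on I)" and g': "sq_integrable (lebesgue_on I) g'"
    and lim_f: "\<And>x. x \<in> I \<Longrightarrow> (\<lambda>n. f n x) \<longlonglongrightarrow> f' x"
    and bound: "\<And>C. compact C \<Longrightarrow> C \<subseteq> I \<Longrightarrow> \<exists>B. \<forall>x\<in>C. \<forall>n. \<bar>f n x\<bar> \<le> B"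
    and lim_g: "(\<lambda>n. \<integral>x. (g n x - g' x)\<^sup>2 \<partial>lebesgue_on I) \<longlonglongrightarrow> 0"
  shows "has_weak_deriv I f' g'"
  unfolding has_weak_deriv_iff
proof (intro allI impI)
  fix \<phi> assume \<phi>: "test_function I \<phi>"
  note t = test_function_sq_integrable[OF \<phi>]
  let ?M = "lebesgue_on I"
  have "(\<lambda>n. \<integral>x. f n x * deriv \<phi> x \<partial>?M) \<longlonglongrightarrow> (\<integral>x. f' x * deriv \<phi> x \<partial>?M)"
  proof -
    obtain C where C: "compact C" "C \<subseteq> interior I" "\<And>x. x \<notin> C \<Longrightarrow> deriv \<phi> x = 0"
      using test_functionE[OF \<phi>] by metis
    have "C \<subseteq> I"
      using C(2) interior_subset by blast
    then obtain B where B: "\<And>x n. x \<in> C \<Longrightarrow> \<bar>f n x\<bar> \<le> B"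
      using bound[OF C(1)] by blast
    have "sq_integrable ?M (indicator C)"
      using C(1) emeasure_bounded_finite[OF compact_imp_bounded, of C]
      by (intro sq_integrable_indicator) (auto simp: borel_compact)
    then have "integrable ?M (\<lambda>x. indicator C x * (B * \<bar>deriv \<phi> x\<bar>))"
      by (intro sq_integrable_mult sq_integrable_cmult sq_integrable_abs t)
    moreover have "norm (f n x * deriv \<phi> x) \<le> indicator C x * (B * \<bar>deriv \<phi> x\<bar>)" for n x
      using B[of x n] C(3)[of x] by (cases "x \<in> C") (auto simp: abs_mult intro: mult_right_mono)
    ultimately show ?thesis
      using f f' t(2) lim_f
      by (intro integral_dominated_convergence[where w = "\<lambda>x. indicator C x * (B * \<bar>deriv \<phi> x\<bar>)"])
        (auto intro!: borel_measurable_times AE_I2 tendsto_mult simp: sq_integrable_def)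
  qed
  moreover have "(\<lambda>n. \<integral>x. g n x * \<phi> x \<partial>?M) \<longlonglongrightarrow> (\<integral>x. g' x * \<phi> x \<partial>?M)"
  proof (rule LIM_zero_cancel, rule tendsto_rabs_zero_cancel,
      rule tendsto_sandwich[of "\<lambda>_. 0"])
    have i: "integrable ?M (\<lambda>x. g n x * \<phi> x)" "integrable ?M (\<lambda>x. g' x * \<phi> x)" for n
      using g g' t(1) by (auto intro: sq_integrable_mult)
    have "\<bar>(\<integral>x. g n x * \<phi> x \<partial>?M) - (\<integral>x. g' x * \<phi> x \<partial>?M)\<bar> \<le>
        sqrt (\<integral>x. (g n x - g' x)\<^sup>2 \<partial>?M) * sqrt (\<integral>x. (\<phi> x)\<^sup>2 \<partial>?M)" for n
    proof -
      have "(\<integral>x. g n x * \<phi> x \<partial>?M) - (\<integral>x. g' x * \<phi> x \<partial>?M) = (\<integral>x. (g n x - g' x) * \<phi> x \<partial>?M)"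
        by (simp add: left_diff_distrib i)
      also have "\<bar>\<dots>\<bar> \<le> sqrt ((\<integral>x. (g n x - g' x)\<^sup>2 \<partial>?M) * (\<integral>x. (\<phi> x)\<^sup>2 \<partial>?M))"
        using Cauchy_Schwarz_integral[OF sq_integrable_diff[OF g g'] t(1), of n]
        by (intro real_le_rsqrt) simp
      finally show ?thesis
        by (simp add: real_sqrt_mult)
    qed
    then show "eventually (\<lambda>n. \<bar>(\<integral>x. g n x * \<phi> x \<partial>?M) - (\<integral>x. g' x * \<phi> x \<partial>?M)\<bar> \<le>
        sqrt (\<integral>x. (g n x - g' x)\<^sup>2 \<partial>?M) * sqrt (\<integral>x. (\<phi> x)\<^sup>2 \<partial>?M)) sequentially"
      by simp
    have "(\<lambda>n. sqrt (\<integral>x. (g n x - g' x)\<^sup>2 \<partial>?M) * sqrt (\<integral>x. (\<phi> x)\<^sup>2 \<partial>?M)) \<longlonglongrightarrow> sqrt 0 * sqrt (\<integral>x. (\<phi> x)\<^sup>2 \<partial>?M)"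
      by (intro tendsto_intros lim_g)
    then show "(\<lambda>n. sqrt (\<integral>x. (g n x - g' x)\<^sup>2 \<partial>?M) * sqrt (\<integral>x. (\<phi> x)\<^sup>2 \<partial>?M)) \<longlonglongrightarrow> 0"
      by simp
  qed auto
  ultimately have "(\<lambda>n. - (\<integral>x. g n x * \<phi> x \<partial>?M)) \<longlonglongrightarrow> (\<integral>x. f' x * deriv \<phi> x \<partial>?M)"
    "(\<lambda>n. - (\<integral>x. g n x * \<phi> x \<partial>?M)) \<longlonglongrightarrow> - (\<integral>x. g' x * \<phi> x \<partial>?M)"
    using wd \<phi> by (auto simp: has_weak_deriv_iff intro: tendsto_minus)
  then show "(\<integral>x. f' x * deriv \<phi> x \<partial>?M) = - (\<integral>x. g' x * \<phi> x \<partial>?M)"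
    by (rule LIMSEQ_unique)
qed

text \<open>
The kernels \<open>t \<mapsto> r bump (r (t - x))\<close> with \<open>r = r\<^sub>n \<rightarrow> \<infinity>\<close> have mass \<open>1\<close> and concentrate at \<open>x\<close> from the
right.
\<close>

lemma tendsto_integral_bump:
  fixes f :: "real \<Rightarrow> real" and r :: "nat \<Rightarrow> real"
  assumes f: "continuous_on {x..x + \<delta>} f" and "\<delta> > 0" and r: "filterlim r at_top sequentially"
  shows "(\<lambda>n. integral {x..x + 1 / r n} (\<lambda>t. f t * (bump ((t - x) * r n) * r n))) \<longlonglongrightarrow> f x"
proof (rule tendstoI)
  fix e :: real assume "e > 0"
  then obtain d where d: "d > 0" "\<And>t. t \<in> {x..x + \<delta>} \<Longrightarrow> dist t x < d \<Longrightarrow> dist (f t) (f x) < e / 2"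
    using f \<open>\<delta> > 0\<close> unfolding continuous_on_iff
    by (metis atLeastAtMost_iff half_gt_zero le_add_same_cancel1 less_imp_le order_refl)
  have "eventually (\<lambda>n. r n > max (1 / d) (1 / \<delta>)) sequentially"
    using r unfolding filterlim_at_top_dense by blast
  then show "eventually (\<lambda>n. dist (integral {x..x + 1 / r n} (\<lambda>t. f t * (bump ((t - x) * r n) * r n))) (f x) < e)
      sequentially"
  proof eventually_elim
    case (elim n)
    define \<rho> where "\<rho> = r n"
    have \<rho>: "\<rho> > 0" "1 / \<rho> < d" "1 / \<rho> < \<delta>"
      using elim d(1) \<open>\<delta> > 0\<close> less_trans[of 0 "1 / d" "r n"] by (auto simp: \<rho>_def field_simps)
    define J where "J = {x..x + 1 / \<rho>}"
    define k where "k t = bump ((t - x) * \<rho>) * \<rho>" for t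
    have J: "J \<subseteq> {x..x + \<delta>}"
      using \<rho> by (auto simp: J_def)
    have close: "dist t x < d" if "t \<in> J" for t
      using that \<rho> by (auto simp: J_def dist_real_def)
    have ck: "continuous_on A k" for A
      unfolding k_def by (intro continuous_intros)
    have k0: "k t \<ge> 0" for t
      using \<rho> by (simp add: k_def bump_nonneg)
    have "((\<lambda>t. smooth_step ((t - x) * \<rho>)) has_real_derivative k t) (at t within A)" for t A
      unfolding k_def by (auto intro!: derivative_eq_intros DERIV_chain2[OF has_real_derivative_smooth_step])
    then have "(k has_integral smooth_step ((x + 1 / \<rho> - x) * \<rho>) - smooth_step ((x - x) * \<rho>)) J"
      unfolding J_def
      by (intro fundamental_theorem_of_calculus) (use \<rho> in \<open>auto simp: has_real_derivative_iff_has_vector_derivative\<close>)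
    then have k1: "(k has_integral 1) J"
      using \<rho> by (simp add: smooth_step_eq_0 smooth_step_eq_1)
    have cJ: "continuous_on J f"
      by (rule continuous_on_subset[OF f J])
    have fk: "(\<lambda>t. f t * k t) integrable_on J" "(\<lambda>t. f x * k t) integrable_on J" "(\<lambda>t. (f t - f x) * k t) integrable_on J"
      "(\<lambda>t. e / 2 * k t) integrable_on J"
      unfolding J_def
      by (intro integrable_continuous_interval continuous_intros ck cJ[unfolded J_def])+
    have "integral J (\<lambda>t. f t * k t) - f x = integral J (\<lambda>t. (f t - f x) * k t)"
      using integral_diff[OF fk(1,2)] integral_unique[OF k1]
      by (simp add: left_diff_distrib)
    also have "norm \<dots> \<le> integral J (\<lambda>t. e / 2 * k t)"
    proof (rule integral_norm_bound_integral[OF fk(3,4)])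
      fix t assume t: "t \<in> J"
      have "\<bar>f t - f x\<bar> \<le> e / 2"
        using d(2)[of t] close[OF t] t J by (auto simp: dist_real_def)
      then show "norm ((f t - f x) * k t) \<le> e / 2 * k t"
        using k0[of t] by (simp only: real_norm_def abs_mult abs_of_nonneg mult_right_mono)
    qed
    also have "\<dots> = e / 2"
      using integral_unique[OF k1] by simp
    finally show ?case
      using \<open>e > 0\<close> unfolding J_def k_def \<rho>_def by (simp add: dist_real_def)
  qed
qed

text \<open>
The test functions \<open>\<phi> n\<close> are smoothed indicators of \<open>{x<..y}\<close>. Their derivatives are a bump next to \<open>x\<close>
minus a bump next to \<open>y\<close>, so \<open>\<integral> f (\<phi> n)'\<close> tends to \<open>f x - f y\<close>, while \<open>\<integral> g (\<phi> n)\<close> tends to the integral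
of \<open>g\<close> over \<open>{x<..y}\<close>.
\<close>

lemma weak_deriv_FTC_interior:
  assumes cf: "continuous_on I f" and g: "sq_integrable (lebesgue_on I) g"
    and wd: "has_weak_deriv I f g"
    and xy: "x \<in> interior I" "y \<in> interior I" "x < y"
  shows "f y - f x = (\<integral>t. g t * indicator {x<..y} t \<partial>lebesgue_on I)"
proof -
  obtain \<delta> where \<delta>: "\<delta> > 0" "y + \<delta> \<in> interior I"
  proof -
    obtain e where "e > 0" "cball y e \<subseteq> interior I"
      using xy(2) open_interior open_contains_cball by blast
    moreover from this have "y + e \<in> cball y e"
      by (simp add: dist_real_def)
    ultimately show thesis
      using that[of e] by auto
  qed
  define r :: "nat \<Rightarrow> real" where "r n = Suc n / \<delta>" for n
  have r: "r n > 0" "1 / r n \<le> \<delta>" for n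
    using \<delta>(1) by (auto simp: r_def field_simps)
  have r_lim: "filterlim r at_top sequentially"
  proof -
    have "filterlim (\<lambda>n. real (Suc n) * (1 / \<delta>)) at_top sequentially"
      using \<delta>(1) by (intro filterlim_at_top_mult_tendsto_pos[OF tendsto_const _ filterlim_compose[OF filterlim_real_sequentially filterlim_Suc]]) simp
    then show ?thesis
      by (simp add: r_def[abs_def])
  qed
  let ?M = "lebesgue_on I"
  \<comment> \<open>The supports shrink to \<open>{x..y}\<close> from the right, inside \<open>{x..y + \<delta>}\<close>.\<close>
  define \<phi> where "\<phi> n t = smooth_step ((t - x) * r n) - smooth_step ((t - y) * r n)" for n t
  define k where "k z n t = bump ((t - z) * r n) * r n" for z n t
  have ck: "continuous_on A (k z n)" for A z n
    unfolding k_def by (intro continuous_intros)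
  have sub: "{x..y + \<delta>} \<subseteq> interior I"
    using Icc_subset_interior xy \<delta> by blast
  have sub': "{x..y + \<delta>} \<subseteq> I"
    using sub interior_subset by blast
  have D: "(\<phi> n has_real_derivative k x n t - k y n t) (at t)" for n t
    unfolding \<phi>_def[abs_def] k_def
    by (auto intro!: derivative_eq_intros DERIV_chain2[OF has_real_derivative_smooth_step])
  then have deriv: "deriv (\<phi> n) t = k x n t - k y n t" for n t
    by (rule DERIV_imp_deriv)
  have \<phi>0: "\<phi> n t = 0" if "t \<notin> {x..y + \<delta>}" for n t
  proof (cases "t < x")
    case True
    then show ?thesis
      using r(1)[of n] xy(3) by (simp add: \<phi>_def smooth_step_eq_0 mult_nonpos_nonneg)
  next
    case False
    then have "t > y + 1 / r n"
      using that r(2)[of n] by auto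
    then have "(t - y) * r n \<ge> 1"
      using r(1)[of n] by (simp add: field_simps)
    moreover have "(t - y) * r n \<le> (t - x) * r n"
      using r(1)[of n] xy(3) by (intro mult_right_mono) auto
    ultimately show ?thesis
      by (simp add: \<phi>_def smooth_step_eq_1)
  qed
  have test: "test_function I (\<phi> n)" for n
    unfolding test_function_def C1_differentiable_on_def
    using D[of n] sub \<phi>0[of _ n]
    by (intro conjI exI[of _ "\<lambda>t. k x n t - k y n t"] exI[of _ "{x..y + \<delta>}"])
      (auto simp: has_real_derivative_iff_has_vector_derivative intro!: continuous_intros ck)
  have kernel: "integrable ?M (\<lambda>t. f t * k z n t)"
    "(\<integral>t. f t * k z n t \<partial>?M) = integral {z..z + 1 / r n} (\<lambda>t. f t * k z n t)" if "z \<in> {x..y}" for z n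
  proof -
    have J: "{z..z + 1 / r n} \<subseteq> I"
      by (rule order_trans[OF _ sub']) (use that r(2)[of n] in auto)
    have k0: "k z n t = 0" if "t \<notin> {z..z + 1 / r n}" for t
    proof -
      have "(t - z) * r n \<le> 0 \<or> (t - z) * r n \<ge> 1"
        using that r(1)[of n] by (auto simp: field_simps not_le mult_le_0_iff)
      then show ?thesis
        by (auto simp: k_def bump_eq_0)
    qed
    have "continuous_on {z..z + 1 / r n} (\<lambda>t. f t * k z n t)"
      by (intro continuous_intros ck continuous_on_subset[OF cf J])
    then have ai: "(\<lambda>t. f t * k z n t) absolutely_integrable_on {z..z + 1 / r n}"
      using absolutely_integrable_continuous_real by blast
    moreover have eq: "(\<lambda>t. indicator I t *\<^sub>R (f t * k z n t)) = (\<lambda>t. indicator {z..z + 1 / r n} t *\<^sub>R (f t * k z n t))"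
      using k0 J by (auto simp: fun_eq_iff indicator_def)
    ultimately show "integrable ?M (\<lambda>t. f t * k z n t)"
      by (simp add: integrable_restrict_space set_integrable_def)
    show "(\<integral>t. f t * k z n t \<partial>?M) = integral {z..z + 1 / r n} (\<lambda>t. f t * k z n t)"
      using set_lebesgue_integral_eq_integral(2)[OF ai] 
      by (simp add: integral_restrict_space set_lebesgue_integral_def eq[unfolded real_scaleR_def])
  qed
  have lim_k: "(\<lambda>n. \<integral>t. f t * k z n t \<partial>?M) \<longlonglongrightarrow> f z" if "z \<in> {x..y}" for z
  proof -
    have "{z..z + \<delta>} \<subseteq> I"
      by (rule order_trans[OF _ sub']) (use that in auto)
    from tendsto_integral_bump[OF continuous_on_subset[OF cf this] \<delta>(1) r_lim] show ?thesis
      unfolding kernel(2)[OF that] unfolding k_def .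
  qed
  have "(\<lambda>n. (\<integral>t. f t * k x n t \<partial>?M) - (\<integral>t. f t * k y n t \<partial>?M)) \<longlonglongrightarrow> f x - f y"
    using xy(3) by (intro tendsto_diff lim_k) auto
  moreover have "(\<integral>t. f t * k x n t \<partial>?M) - (\<integral>t. f t * k y n t \<partial>?M) = - (\<integral>t. g t * \<phi> n t \<partial>?M)" for n
    using wd test[of n] kernel(1)[of x n] kernel(1)[of y n] xy(3)
    unfolding has_weak_deriv_iff
    by (auto simp: deriv right_diff_distrib simp flip: Bochner_Integration.integral_diff)
  ultimately have 1: "(\<lambda>n. - (\<integral>t. g t * \<phi> n t \<partial>?M)) \<longlonglongrightarrow> f x - f y"
    by simp
  have "(\<lambda>n. \<integral>t. g t * \<phi> n t \<partial>?M) \<longlonglongrightarrow> (\<integral>t. g t * indicator {x<..y} t \<partial>?M)"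
  proof (rule integral_dominated_convergence[where w = "\<lambda>t. \<bar>g t\<bar> * indicator {x..y + \<delta>} t"])
    show "(\<lambda>t. g t * indicator {x<..y} t) \<in> borel_measurable ?M"
      using sq_integrable_mult[OF g sq_integrable_indicator_Ioc] by (rule borel_measurable_integrable)
    show "(\<lambda>t. g t * \<phi> n t) \<in> borel_measurable ?M" for n
      using sq_integrable_mult[OF g test_function_sq_integrable(1)[OF test]] by (rule borel_measurable_integrable)
    show "integrable ?M (\<lambda>t. \<bar>g t\<bar> * indicator {x..y + \<delta>} t)"
      by (intro sq_integrable_mult sq_integrable_abs g sq_integrable_indicator_Icc)
    have "\<bar>\<phi> n t\<bar> \<le> indicator {x..y + \<delta>} t" for n t
      using \<phi>0[of t n] smooth_step_bounds[of "(t - x) * r n"] smooth_step_bounds[of "(t - y) * r n"]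
      by (auto simp: indicator_def \<phi>_def abs_le_iff)
    then show "AE t in ?M. norm (g t * \<phi> n t) \<le> \<bar>g t\<bar> * indicator {x..y + \<delta>} t" for n
      by (intro AE_I2) (auto simp: abs_mult intro: mult_left_mono)
    have step: "(\<lambda>n. smooth_step ((t - z) * r n)) \<longlonglongrightarrow> indicator {z<..} t" for t z
    proof (cases "t \<le> z")
      case True
      then show ?thesis
        using r(1) by (simp add: smooth_step_eq_0 mult_nonpos_nonneg less_imp_le)
    next
      case False
      have "filterlim (\<lambda>n. (t - z) * r n) at_top sequentially"
        using False by (intro filterlim_tendsto_pos_mult_at_top[OF tendsto_const _ r_lim]) auto
      then have "eventually (\<lambda>n. (t - z) * r n \<ge> 1) sequentially"
        by (simp add: filterlim_at_top)
      then have "eventually (\<lambda>n. smooth_step ((t - z) * r n) = indicator {z<..} t) sequentially"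
        by eventually_elim (use False in \<open>auto simp: smooth_step_eq_1\<close>)
      then show ?thesis
        by (rule tendsto_eventually)
    qed
    have "(\<lambda>n. g t * \<phi> n t) \<longlonglongrightarrow> g t * (indicator {x<..} t - indicator {y<..} t)" for t
      unfolding \<phi>_def by (intro tendsto_intros step)
    moreover have "indicator {x<..} t - indicator {y<..} t = (indicator {x<..y} t :: real)" for t
      using xy(3) by (auto simp: indicator_def)
    ultimately show "AE t in ?M. (\<lambda>n. g t * \<phi> n t) \<longlonglongrightarrow> g t * indicator {x<..y} t"
      by (intro AE_I2) simp
  qed
  then have "(\<lambda>n. - (\<integral>t. g t * \<phi> n t \<partial>?M)) \<longlonglongrightarrow> - (\<integral>t. g t * indicator {x<..y} t \<partial>?M)"
    by (rule tendsto_minus)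
  from LIMSEQ_unique[OF 1 this] show ?thesis
    by simp
qed

text \<open>
The Cauchy-Schwarz inequality applied to the integral of \<open>g\<close> between two interior points; both sides are
continuous up to the boundary of the interval.
\<close>

lemma weak_deriv_increment_bound:
  assumes cf: "continuous_on I f" and g: "sq_integrable (lebesgue_on I) g"
    and wd: "has_weak_deriv I f g" and xy: "x \<in> I" "y \<in> I"
  shows "(f y - f x)\<^sup>2 \<le> \<bar>y - x\<bar> * (\<integral>t. (g t)\<^sup>2 \<partial>lebesgue_on I)"
proof -
  define B where "B = (\<integral>t. (g t)\<^sup>2 \<partial>lebesgue_on I)"
  have less: "(f y - f x)\<^sup>2 \<le> (y - x) * B" if "x \<in> interior I" "y \<in> interior I" "x < y" for x y
  proof -
    have "{x..y} \<subseteq> I"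
      by (rule order_trans[OF Icc_subset_interior[OF that(1,2)] interior_subset])
    then have "t \<in> I" if "x < t" "t \<le> y" for t
      using that by auto
    then have "(\<lambda>t. indicator I t * (indicator {x<..y} t)\<^sup>2) = (indicator {x<..y} :: real \<Rightarrow> real)"
      by (auto simp: fun_eq_iff indicator_def)
    then have "(\<integral>t. (indicator {x<..y} t)\<^sup>2 \<partial>lebesgue_on I) = y - x"
      using that(3) by (simp add: integral_restrict_space)
    then show ?thesis
      using Cauchy_Schwarz_integral[OF g sq_integrable_indicator_Ioc[of x y]]
      unfolding weak_deriv_FTC_interior[OF cf g wd that] B_def by (simp add: mult.commute)
  qed
  have interior: "0 \<le> \<bar>y - x\<bar> * B - (f y - f x)\<^sup>2" if "x \<in> interior I" "y \<in> interior I" for x y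
    using less[of x y] less[of y x] that by (cases x y rule: linorder_cases) (auto simp: power2_commute)
  have cl: "closure (interior I \<times> interior I) = I \<times> I"
    using convex_closure_interior[OF convex interior_nonempty] closure_closed[OF closed]
    by (simp add: closure_Times)
  have c: "continuous_on (I \<times> I) (\<lambda>p. f (fst p))" "continuous_on (I \<times> I) (\<lambda>p. f (snd p))"
    by (rule continuous_on_compose2[OF cf]; force intro: continuous_on_fst continuous_on_snd continuous_on_id)+
  have "continuous_on (I \<times> I) (\<lambda>p. \<bar>snd p - fst p\<bar> * B - (f (snd p) - f (fst p))\<^sup>2)"
    by (intro continuous_intros c)
  then have "(\<lambda>p. \<bar>snd p - fst p\<bar> * B - (f (snd p) - f (fst p))\<^sup>2) (x, y) \<ge> 0"
  proof (rule continuous_ge_on_closure[of "interior I \<times> interior I", unfolded cl])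
    show "(x, y) \<in> I \<times> I"
      using xy by simp
    show "0 \<le> \<bar>snd p - fst p\<bar> * B - (f (snd p) - f (fst p))\<^sup>2" if "p \<in> interior I \<times> interior I" for p
      using that interior[of "fst p" "snd p"] by (simp add: mem_Times_iff)
  qed
  then show ?thesis
    by (simp add: B_def)
qed

text \<open>
By the fundamental theorem the difference of two weak derivatives has integral \<open>0\<close> over every small
interval, so it vanishes at its Lebesgue points.
\<close>

lemma weak_deriv_unique:
  assumes cf: "continuous_on I f"
    and g1: "sq_integrable (lebesgue_on I) g1" "has_weak_deriv I f g1"
    and g2: "sq_integrable (lebesgue_on I) g2" "has_weak_deriv I f g2"
  shows "AE t in lebesgue_on I. g1 t = g2 t"
proof -
  define h where "h t = g1 t - g2 t" for t
  have h: "sq_integrable (lebesgue_on I) h"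
    unfolding h_def by (intro sq_integrable_diff g1 g2)
  define k where "k t = indicator I t * h t" for t
  have k_Icc: "k absolutely_integrable_on {a..b}" for a b
  proof -
    have "integrable (lebesgue_on I) (\<lambda>t. h t * indicator {a..b} t)"
      by (intro sq_integrable_mult h sq_integrable_indicator_Icc)
    then show ?thesis
      by (simp add: integrable_restrict_space set_integrable_def k_def mult_ac)
  qed
  have zero: "integral {x..y} k = 0" if xy: "x \<in> interior I" "y \<in> interior I" "x < y" for x y
  proof -
    have "0 = (\<integral>t. h t * indicator {x<..y} t \<partial>lebesgue_on I)"
      using weak_deriv_FTC_interior[OF cf g1 xy] weak_deriv_FTC_interior[OF cf g2 xy]
        sq_integrable_mult[OF g1(1) sq_integrable_indicator_Ioc[of x y]]
        sq_integrable_mult[OF g2(1) sq_integrable_indicator_Ioc[of x y]]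
      by (simp add: h_def left_diff_distrib)
    also have "\<dots> = (LINT t:{x<..y}|lebesgue. k t)"
      by (simp add: integral_restrict_space set_lebesgue_integral_def k_def mult_ac)
    also have "\<dots> = integral {x<..y} k"
      by (intro set_lebesgue_integral_eq_integral set_integrable_subset[OF k_Icc[of x y]]) auto
    also have "\<dots> = integral {x..y} k"
      by (rule integral_subset_negligible) (auto intro: negligible_subset[of "{x}"])
    finally show ?thesis
      by simp
  qed
  obtain N where N: "negligible N"
    "\<And>x e. x \<notin> N \<Longrightarrow> 0 < e \<Longrightarrow> \<exists>d>0. \<forall>s. 0 < s \<and> s < d \<longrightarrow>
      norm (integral (cbox x (x + s *\<^sub>R One)) k /\<^sub>R s ^ DIM(real) - k x) < e"
  proof (rule integrable_ccontinuous_explicit[of k])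
    show "k integrable_on cbox a b" for a b
      using set_lebesgue_integral_eq_integral(1)[OF k_Icc] by simp
  qed (rule that)
  have k0: "k x = 0" if x: "x \<in> interior I" "x \<notin> N" for x
  proof (rule ccontr)
    assume "k x \<noteq> 0"
    then obtain d where d: "d > 0" "\<And>s. 0 < s \<Longrightarrow> s < d \<Longrightarrow> norm (integral {x..x + s} k / s - k x) < \<bar>k x\<bar>"
      using N(2)[OF x(2), of "\<bar>k x\<bar>"] by (auto simp: divide_inverse mult.commute)
    obtain e where e: "e > 0" "cball x e \<subseteq> interior I"
      using x(1) open_interior open_contains_cball by blast
    define s where "s = min (d / 2) e"
    have "x + s \<in> cball x e"
      using d e by (auto simp: s_def dist_real_def)
    then have "integral {x..x + s} k = 0"
      using d e x by (intro zero) (auto simp: s_def)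
    moreover have "norm (integral {x..x + s} k / s - k x) < \<bar>k x\<bar>"
      using d e by (intro d(2)) (auto simp: s_def)
    ultimately show False
      by simp
  qed
  have "negligible (frontier I)"
    by (rule negligible_convex_frontier[OF convex])
  then have "N \<union> frontier I \<in> null_sets lebesgue"
    using N(1) by (auto simp: negligible_iff_null_sets[symmetric])
  then have "AE x in lebesgue. x \<notin> N \<union> frontier I"
    by (rule AE_not_in)
  then have "AE x in lebesgue. x \<in> I \<longrightarrow> g1 x = g2 x"
  proof eventually_elim
    case (elim x)
    show ?case
    proof
      assume "x \<in> I"
      then have "x \<in> interior I"
        using elim closure_subset[of I] by (auto simp: frontier_def)
      with elim \<open>x \<in> I\<close> show "g1 x = g2 x"
        using k0[of x] by (simp add: k_def h_def)
    qed
  qed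
  then show ?thesis
    by (simp add: AE_restrict_space_iff)
qed

text \<open>
Integration by parts: the product of \<open>f\<close> with a test function vanishes at both ends of a large interval.
\<close>

lemma has_weak_deriv_classical:
  assumes f: "\<And>x. (f has_real_derivative f' x) (at x)" and cf': "continuous_on UNIV f'"
  shows "has_weak_deriv I f f'"
  unfolding has_weak_deriv_iff
proof (intro allI impI)
  fix \<phi> assume "test_function I \<phi>"
  from test_functionE[OF this] obtain C where C: "compact C" "C \<subseteq> interior I"
    and \<phi>0: "\<And>x. x \<notin> C \<Longrightarrow> \<phi> x = 0" "\<And>x. x \<notin> C \<Longrightarrow> deriv \<phi> x = 0"
    and D: "\<And>x. (\<phi> has_real_derivative deriv \<phi> x) (at x)"
    and c\<phi>: "continuous_on UNIV \<phi>" "continuous_on UNIV (deriv \<phi>)"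
    by metis
  have CI: "C \<subseteq> I"
    using C(2) interior_subset by blast
  have cf: "continuous_on UNIV f"
    using f by (intro continuous_at_imp_continuous_on) (auto intro: DERIV_isCont)
  define h where "h x = f x * deriv \<phi> x + f' x * \<phi> x" for x
  have h0: "h x = 0" if "x \<notin> C" for x
    using \<phi>0[OF that] by (simp add: h_def)
  have ch: "continuous_on A h" for A
    unfolding h_def
    by (intro continuous_intros continuous_on_subset[OF c\<phi>(1)] continuous_on_subset[OF c\<phi>(2)]
      continuous_on_subset[OF cf] continuous_on_subset[OF cf']) auto
  have i: "integrable (lebesgue_on I) (\<lambda>x. f x * deriv \<phi> x)" "integrable (lebesgue_on I) (\<lambda>x. f' x * \<phi> x)"
    by (rule integrable_compact_support[OF _ C(1) CI];
      (intro continuous_intros cf cf' c\<phi>)?; simp add: \<phi>0)+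
  obtain b where b: "b > 0" "C \<subseteq> {-b<..<b}"
  proof -
    obtain B where B: "\<And>x. x \<in> C \<Longrightarrow> \<bar>x\<bar> \<le> B"
      using compact_imp_bounded[OF C(1)] by (auto simp: bounded_iff)
    have "x \<in> {- (\<bar>B\<bar> + 1)<..<\<bar>B\<bar> + 1}" if "x \<in> C" for x
      using B[OF that] by auto
    then show thesis
      by (intro that[of "\<bar>B\<bar> + 1"] subsetI) auto
  qed
  have "((\<lambda>x. f x * \<phi> x) has_real_derivative h x) (at x within {-b..b})" for x
    unfolding h_def by (auto intro!: derivative_eq_intros DERIV_subset[OF f] DERIV_subset[OF D])
  then have "(h has_integral f b * \<phi> b - f (-b) * \<phi> (-b)) {-b..b}"
    using b(1) by (intro fundamental_theorem_of_calculus) (auto simp: has_real_derivative_iff_has_vector_derivative)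
  moreover have "\<phi> b = 0" "\<phi> (-b) = 0"
    using b by (auto intro!: \<phi>0(1))
  ultimately have "integral {-b..b} h = 0"
    by (simp add: integral_unique)
  moreover have "integral {-b..b} h = (LINT x:{-b..b}|lebesgue. h x)"
    by (intro set_lebesgue_integral_eq_integral(2)[symmetric] absolutely_integrable_continuous_real ch)
  moreover have "(\<lambda>x. indicator {-b..b} x * h x) = (\<lambda>x. indicator I x * h x)"
    using h0 CI b by (fastforce simp: fun_eq_iff indicator_def)
  ultimately have "(\<integral>x. h x \<partial>lebesgue_on I) = 0"
    by (simp add: integral_restrict_space set_lebesgue_integral_def)
  then show "(\<integral>x. f x * deriv \<phi> x \<partial>lebesgue_on I) = - (\<integral>x. f' x * \<phi> x \<partial>lebesgue_on I)"
    using i by (simp add: h_def)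
qed

end

section \<open>The Dirichlet integral on an interval\<close>

definition dirichlet :: "real set \<Rightarrow> (real \<Rightarrow> real) \<Rightarrow> real" where
  "dirichlet I f = (\<integral>x. (weak_deriv I f x)\<^sup>2 \<partial>lebesgue_on I)"

lemma dirichlet_nonneg: "0 \<le> dirichlet I f"
  by (simp add: dirichlet_def)

context closed_interval
begin

lemma H1_onI:
  assumes "sq_integrable (lebesgue_on I) f" "sq_integrable (lebesgue_on I) g" "has_weak_deriv I f g"
  shows "f \<in> H1_on I"
  using assms by (auto simp: H1_on_def Lq_on_2_iff)

lemma H1_onD:
  assumes "f \<in> H1_on I"
  shows "sq_integrable (lebesgue_on I) f" "sq_integrable (lebesgue_on I) (weak_deriv I f)"
    "has_weak_deriv I f (weak_deriv I f)"
proof -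
  have "\<exists>g. g \<in> Lq_on 2 I \<and> has_weak_deriv I f g"
    using assms by (auto simp: H1_on_def)
  then have "weak_deriv I f \<in> Lq_on 2 I \<and> has_weak_deriv I f (weak_deriv I f)"
    unfolding weak_deriv_def by (rule someI_ex)
  then show "sq_integrable (lebesgue_on I) (weak_deriv I f)" "has_weak_deriv I f (weak_deriv I f)"
    by (auto simp: Lq_on_2_iff)
  show "sq_integrable (lebesgue_on I) f"
    using assms by (auto simp: H1_on_def Lq_on_2_iff)
qed

text \<open>
The derivative chosen in the definition of the Dirichlet integral may be replaced by any weak derivative.
\<close>

lemma dirichlet_eq:
  assumes cf: "continuous_on I f" and f: "f \<in> H1_on I"
    and g: "sq_integrable (lebesgue_on I) g" "has_weak_deriv I f g"
  shows "dirichlet I f = (\<integral>x. (g x)\<^sup>2 \<partial>lebesgue_on I)"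
  unfolding dirichlet_def
proof (rule integral_cong_AE)
  show "AE x in lebesgue_on I. (weak_deriv I f x)\<^sup>2 = (g x)\<^sup>2"
    using weak_deriv_unique[OF cf H1_onD(2,3)[OF f] g] by eventually_elim simp
qed (use sq_integrableD(2)[OF g(1)] sq_integrableD(2)[OF H1_onD(2)[OF f]] in \<open>auto intro: borel_measurable_integrable\<close>)

lemma dirichlet_increment_bound:
  assumes "continuous_on I f" "f \<in> H1_on I" "x \<in> I" "y \<in> I"
  shows "(f y - f x)\<^sup>2 \<le> \<bar>y - x\<bar> * dirichlet I f"
  unfolding dirichlet_def using weak_deriv_increment_bound[OF assms(1) H1_onD(2,3)[OF assms(2)] assms(3,4)] .

lemma H1_on_lincomb:
  assumes "f1 \<in> H1_on I" "f2 \<in> H1_on I"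
  shows "(\<lambda>x. a * f1 x + b * f2 x) \<in> H1_on I"
  using H1_onD[OF assms(1)] H1_onD[OF assms(2)]
  by (intro H1_onI[where g = "\<lambda>x. a * weak_deriv I f1 x + b * weak_deriv I f2 x"]
    sq_integrable_add sq_integrable_cmult has_weak_deriv_lincomb)

lemma dirichlet_lincomb:
  assumes c: "continuous_on I f1" "continuous_on I f2" and f: "f1 \<in> H1_on I" "f2 \<in> H1_on I"
  shows "dirichlet I (\<lambda>x. a * f1 x + b * f2 x) =
    (\<integral>x. (a * weak_deriv I f1 x + b * weak_deriv I f2 x)\<^sup>2 \<partial>lebesgue_on I)"
  using H1_onD[OF f(1)] H1_onD[OF f(2)]
  by (intro dirichlet_eq H1_on_lincomb f continuous_on_add continuous_on_mult continuous_on_const c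
    sq_integrable_add sq_integrable_cmult has_weak_deriv_lincomb)

lemma dirichlet_cmult:
  assumes "continuous_on I f" "f \<in> H1_on I"
  shows "dirichlet I (\<lambda>x. a * f x) = a\<^sup>2 * dirichlet I f"
  using dirichlet_lincomb[OF assms(1,1) assms(2,2), of a 0] by (simp add: power_mult_distrib dirichlet_def)

lemma dirichlet_parallelogram:
  assumes c: "continuous_on I f1" "continuous_on I f2" and f: "f1 \<in> H1_on I" "f2 \<in> H1_on I"
  shows "dirichlet I (\<lambda>x. 1/2 * f1 x + 1/2 * f2 x) + 1/4 * dirichlet I (\<lambda>x. f1 x - f2 x) =
    1/2 * dirichlet I f1 + 1/2 * dirichlet I f2"
proof -
  note w = H1_onD(2)[OF f(1)] H1_onD(2)[OF f(2)]
  define X where "X = (\<integral>x. weak_deriv I f1 x * weak_deriv I f2 x \<partial>lebesgue_on I)"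
  have "dirichlet I (\<lambda>x. 1/2 * f1 x + 1/2 * f2 x) = 1/4 * dirichlet I f1 + 1/2 * X + 1/4 * dirichlet I f2"
    using dirichlet_lincomb[OF c f, of "1/2" "1/2"] integral_square_lincomb[OF w, of "1/2" "1/2"]
    by (simp add: dirichlet_def X_def power2_eq_square)
  moreover have "dirichlet I (\<lambda>x. f1 x - f2 x) = dirichlet I f1 - 2 * X + dirichlet I f2"
    using dirichlet_lincomb[OF c f, of 1 "-1"] integral_square_lincomb[OF w, of 1 "-1"]
    by (simp add: dirichlet_def X_def)
  ultimately show ?thesis
    by linarith
qed

text \<open>
The derivatives converge in \<open>L\<^sup>2\<close> by completeness. The increments of the functions from \<open>x0\<close> are controlled
by the derivatives, so the functions themselves converge pointwise and locally boundedly, and the limit of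
the derivatives is the weak derivative of the pointwise limit.
\<close>

lemma H1_on_limit:
  assumes f: "\<And>n. f n \<in> H1_on I" and c: "\<And>n. continuous_on I (f n)"
    and rapid: "\<And>n m. n \<le> m \<Longrightarrow> dirichlet I (\<lambda>x. f m x - f n x) \<le> (1/4) ^ n"
    and x0: "x0 \<in> I" "convergent (\<lambda>n. f n x0)"
    and B: "\<And>n. (\<integral>x. (f n x)\<^sup>2 \<partial>lebesgue_on I) \<le> B"
  obtains h where "h \<in> H1_on I" "continuous_on I h" "\<And>x. x \<in> I \<Longrightarrow> (\<lambda>n. f n x) \<longlonglongrightarrow> h x"
    "(\<lambda>n. dirichlet I (f n)) \<longlonglongrightarrow> dirichlet I h"
    "\<And>c. c < (\<integral>x. (h x)\<^sup>2 \<partial>lebesgue_on I) \<Longrightarrow>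
      eventually (\<lambda>n. c < (\<integral>x. (f n x)\<^sup>2 \<partial>lebesgue_on I)) sequentially"
proof -
  let ?M = "lebesgue_on I"
  define g where "g n = weak_deriv I (f n)" for n
  have sf: "sq_integrable ?M (f n)" and sg: "sq_integrable ?M (g n)" and wd: "has_weak_deriv I (f n) (g n)" for n
    using H1_onD[OF f] by (auto simp: g_def)
  have diff: "(\<lambda>x. f m x - f n x) \<in> H1_on I" "continuous_on I (\<lambda>x. f m x - f n x)"
    "dirichlet I (\<lambda>x. f m x - f n x) = (\<integral>x. (g m x - g n x)\<^sup>2 \<partial>?M)" for m n
    using H1_on_lincomb[OF f f, of 1 m "-1" n] dirichlet_lincomb[OF c c f f, of 1 m "-1" n] c
    by (auto simp: g_def intro: continuous_on_diff)
  have "(\<integral>x. (g m x - g n x)\<^sup>2 \<partial>?M) \<le> (1/4) ^ n" if "n \<le> m" for m n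
    using rapid[OF that] diff(3) by simp
  then obtain g' where g': "sq_integrable ?M g'" "(\<lambda>n. \<integral>x. (g n x - g' x)\<^sup>2 \<partial>?M) \<longlonglongrightarrow> 0"
    by (rule Riesz_Fischer_rapidly_Cauchy[OF sg])
  have dlim: "(\<lambda>n. dirichlet I (f n)) \<longlonglongrightarrow> (\<integral>x. (g' x)\<^sup>2 \<partial>?M)"
    using tendsto_square_integral[OF sg g'] by (simp add: dirichlet_def g_def)
  obtain D where D: "\<And>n. dirichlet I (f n) \<le> D"
  proof -
    obtain K where "\<forall>n. norm (dirichlet I (f n)) \<le> K"
      using convergent_imp_Bseq[OF convergentI[OF dlim]] unfolding Bseq_def by blast
    then show thesis
      by (intro that[of K]) (auto dest: abs_le_D1)
  qed
  have "convergent (\<lambda>n. f n x)" if x: "x \<in> I" for x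
  proof -
    define d where "d n = f n x - f n x0" for n
    have est: "(d m - d n)\<^sup>2 \<le> \<bar>x - x0\<bar> * (1/4) ^ n" if "n \<le> m" for m n
      using dirichlet_increment_bound[OF diff(2,1) x0(1) x, of m n]
        mult_left_mono[OF rapid[OF that], of "\<bar>x - x0\<bar>"] by (simp add: d_def algebra_simps)
    have "Cauchy d"
    proof (rule metric_CauchyI)
      fix e :: real assume "e > 0"
      have "(\<lambda>n. \<bar>x - x0\<bar> * (1/4) ^ n) \<longlonglongrightarrow> \<bar>x - x0\<bar> * 0"
        by (intro tendsto_intros LIMSEQ_realpow_zero) auto
      then have "eventually (\<lambda>n. \<bar>x - x0\<bar> * (1/4) ^ n < e\<^sup>2) sequentially"
        using order_tendstoD(2)[of _ 0 sequentially "e\<^sup>2"] \<open>e > 0\<close> by simp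
      then obtain k where k: "\<And>n. n \<ge> k \<Longrightarrow> \<bar>x - x0\<bar> * (1/4) ^ n < e\<^sup>2"
        by (auto simp: eventually_sequentially)
      have "dist (d m) (d n) < e" if "n \<ge> k" "n \<le> m" for m n
      proof -
        have "\<bar>d m - d n\<bar>\<^sup>2 < e\<^sup>2"
          using est[OF that(2)] k[OF that(1)] by simp
        then show ?thesis
          using \<open>e > 0\<close> power2_less_imp_less[of "\<bar>d m - d n\<bar>" e] by (simp add: dist_real_def)
      qed
      then show "\<exists>k. \<forall>m\<ge>k. \<forall>n\<ge>k. dist (d m) (d n) < e"
        by (metis dist_commute nle_le)
    qed
    then have "convergent (\<lambda>n. d n + f n x0)"
      by (intro convergent_add x0(2)) (simp add: Cauchy_convergent)
    then show ?thesis
      by (simp add: d_def)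
  qed
  then have lim: "(\<lambda>n. f n x) \<longlonglongrightarrow> lim (\<lambda>n. f n x)" if "x \<in> I" for x
    using that by (simp add: convergent_LIMSEQ_iff)
  define h where "h x = lim (\<lambda>n. f n x)" for x
  have incr: "(f n y - f n x)\<^sup>2 \<le> \<bar>y - x\<bar> * D" if "x \<in> I" "y \<in> I" for n x y
    by (rule order_trans[OF dirichlet_increment_bound[OF c f that]])
      (rule mult_left_mono[OF D abs_ge_zero])
  have h_incr: "(h y - h x)\<^sup>2 \<le> \<bar>y - x\<bar> * D" if "x \<in> I" "y \<in> I" for x y
  proof (rule LIMSEQ_le_const2)
    show "(\<lambda>n. (f n y - f n x)\<^sup>2) \<longlonglongrightarrow> (h y - h x)\<^sup>2"
      unfolding h_def by (intro tendsto_power tendsto_diff lim that)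
    show "\<exists>N. \<forall>n\<ge>N. (f n y - f n x)\<^sup>2 \<le> \<bar>y - x\<bar> * D"
      using incr[OF that] by blast
  qed
  have ch: "continuous_on I h"
    unfolding continuous_on_def
  proof (intro ballI)
    fix x assume x: "x \<in> I"
    have "((\<lambda>y. sqrt (\<bar>y - x\<bar> * D)) \<longlongrightarrow> sqrt (\<bar>x - x\<bar> * D)) (at x within I)"
      by (intro tendsto_intros)
    then have *: "((\<lambda>y. sqrt (\<bar>y - x\<bar> * D)) \<longlongrightarrow> 0) (at x within I)"
      by simp
    have "eventually (\<lambda>y. norm (h y - h x) \<le> sqrt (\<bar>y - x\<bar> * D)) (at x within I)"
      using h_incr[OF x] by (auto simp: eventually_at_filter intro!: always_eventually real_le_rsqrt)
    from Lim_null_comparison[OF this *] show "(h \<longlongrightarrow> h x) (at x within I)"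
      by (rule LIM_zero_cancel)
  qed
  have hm: "h \<in> borel_measurable ?M"
    using ch by (intro continuous_imp_measurable_on_sets_lebesgue) auto
  have sh: "sq_integrable ?M h"
    by (rule square_integral_Fatou(1)[OF sf hm _ B]) (auto simp: h_def intro!: AE_I2 lim)
  have bound: "\<exists>b. \<forall>x\<in>C. \<forall>n. \<bar>f n x\<bar> \<le> b" if C: "compact C" "C \<subseteq> I" for C
  proof -
    obtain b0 where b0: "\<And>n. \<bar>f n x0\<bar> \<le> b0"
      using convergent_imp_Bseq[OF x0(2)] by (auto simp: Bseq_def)
    obtain b1 where b1: "\<And>x. x \<in> C \<Longrightarrow> \<bar>x - x0\<bar> \<le> b1"
      using compact_imp_bounded[OF C(1)] unfolding bounded_any_center[where a = x0]
      by (auto simp: dist_real_def abs_minus_commute)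
    have "D \<ge> 0"
      using D[of 0] dirichlet_nonneg[of I "f 0"] by simp
    have "\<bar>f n x\<bar> \<le> b0 + sqrt (b1 * D)" if "x \<in> C" for n x
    proof -
      have "(f n x - f n x0)\<^sup>2 \<le> b1 * D"
        by (rule order_trans[OF incr[OF x0(1)]])
          (use C(2) that mult_right_mono[OF b1[OF that] \<open>D \<ge> 0\<close>] in auto)
      then have "\<bar>f n x - f n x0\<bar> \<le> sqrt (b1 * D)"
        by (intro real_le_rsqrt) simp
      then show ?thesis
        using b0[of n] by linarith
    qed
    then show ?thesis
      by blast
  qed
  have wdh: "has_weak_deriv I h g'"
    by (rule has_weak_deriv_limit[OF sf sg wd hm g'(1) _ bound g'(2)]) (auto simp: h_def intro: lim)
  have hH: "h \<in> H1_on I"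
    by (rule H1_onI[OF sh g'(1) wdh])
  show thesis
  proof (rule that[OF hH ch])
    show lim': "(\<lambda>n. f n x) \<longlonglongrightarrow> h x" if "x \<in> I" for x
      using lim[OF that] by (simp add: h_def)
    show "(\<lambda>n. dirichlet I (f n)) \<longlonglongrightarrow> dirichlet I h"
      using dlim dirichlet_eq[OF ch hH g'(1) wdh] by simp
    show "eventually (\<lambda>n. c < (\<integral>x. (f n x)\<^sup>2 \<partial>?M)) sequentially" if "c < (\<integral>x. (h x)\<^sup>2 \<partial>?M)" for c
      by (rule square_integral_lower_semicontinuous[OF sf sh _ that]) (auto intro!: AE_I2 lim')
  qed
qed

end

section \<open>The Sobolev space of a metric graph\<close>

lemma interval_finite: "len G e = ereal l \<Longrightarrow> interval G e = {0..l}"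
  by (auto simp: interval_def)

lemma interval_infinite: "len G e = \<infinity> \<Longrightarrow> interval G e = {0..}"
  by (auto simp: interval_def)

lemma closed_interval_interval:
  assumes "0 < len G e" shows "closed_interval (interval G e)"
proof (cases "len G e")
  case (real l)
  then show ?thesis
    using assms by unfold_locales (auto simp: interval_finite)
next
  case PInf
  have "1 \<in> interior {0::real..}"
    by (simp add: interior_real_atLeast)
  then show ?thesis
    using PInf by unfold_locales (auto simp: interval_infinite)
qed (use assms in auto)

definition graph_dirichlet :: "('v, 'e) metric_graph \<Rightarrow> ('e \<Rightarrow> real \<Rightarrow> real) \<Rightarrow> real" where
  "graph_dirichlet G u = (\<Sum>e\<in>edges G. dirichlet (interval G e) (u e))"

definition graph_mass :: "('v, 'e) metric_graph \<Rightarrow> ('e \<Rightarrow> real \<Rightarrow> real) \<Rightarrow> real" where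
  "graph_mass G u = (\<Sum>e\<in>edges G. \<integral>x. (u e x)\<^sup>2 \<partial>lebesgue_on (interval G e))"

text \<open>
The length of an initial segment of the edge on which functions are compared uniformly: the whole edge if it
is finite, and the unit interval on a half-line, which suffices to control the value at its starting point.
\<close>

definition segment_length :: "('v, 'e) metric_graph \<Rightarrow> 'e \<Rightarrow> real" where
  "segment_length G e = (if len G e < \<infinity> then real_of_ereal (len G e) else 1)"

lemma graph_dirichlet_nonneg: "0 \<le> graph_dirichlet G u"
  by (simp add: graph_dirichlet_def dirichlet_nonneg sum_nonneg)

lemma graph_mass_nonneg: "0 \<le> graph_mass G u"
  by (simp add: graph_mass_def sum_nonneg)

text \<open>
The inequality \<open>(f x)\<^sup>2 \<le> 2 (f y)\<^sup>2 + 2 l D\<close>, which follows from the Hoelder estimate, is averaged over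
\<open>y\<close> in \<open>{0..l}\<close>.
\<close>

lemma (in closed_interval) H1_on_sup_bound:
  assumes f: "f \<in> H1_on I" "continuous_on I f" and l: "0 < l" "{0..l} \<subseteq> I" "x \<in> {0..l}"
  shows "(f x)\<^sup>2 \<le> 2 / l * (\<integral>y. (f y)\<^sup>2 \<partial>lebesgue_on I) + 2 * l * dirichlet I f"
proof -
  let ?M = "lebesgue_on I"
  define D where "D = dirichlet I f"
  have D0: "D \<ge> 0"
    by (simp add: D_def dirichlet_nonneg)
  have ptw: "(f x)\<^sup>2 \<le> 2 * (f y)\<^sup>2 + 2 * l * D" if y: "y \<in> {0..l}" for y
  proof -
    have "(f x - f y)\<^sup>2 \<le> \<bar>x - y\<bar> * D"
      unfolding D_def using l y by (intro dirichlet_increment_bound f) auto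
    also have "\<dots> \<le> l * D"
      using l y by (intro mult_right_mono D0) auto
    finally have "(f x - f y)\<^sup>2 \<le> l * D" .
    moreover have "(f x)\<^sup>2 \<le> 2 * (f y)\<^sup>2 + 2 * (f x - f y)\<^sup>2"
      using zero_le_power2[of "f x - 2 * f y"] by (simp add: power2_eq_square algebra_simps)
    ultimately show ?thesis
      by linarith
  qed
  have ind: "integrable ?M (indicator {0..l} :: real \<Rightarrow> real)"
    using sq_integrable_mult[OF sq_integrable_indicator_Icc sq_integrable_indicator_Icc, of 0 l 0 l]
    by (simp flip: indicator_inter_arith)
  have "(\<lambda>t. indicator I t * indicator {0..l} t) = (indicator {0..l} :: real \<Rightarrow> real)"
    using l(2) by (auto simp: fun_eq_iff indicator_def)
  moreover have "(\<integral>y. indicator {0..l} y \<partial>?M) = (\<integral>y. indicator I y *\<^sub>R (indicator {0..l} y :: real) \<partial>lebesgue)"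
    by (rule integral_restrict_space) simp
  ultimately have ind_int: "(\<integral>y. indicator {0..l} y \<partial>?M) = l"
    using l(1) by simp
  have sq: "integrable ?M (\<lambda>y. (f y)\<^sup>2)"
    using sq_integrableD(2)[OF H1_onD(1)[OF f(1)]] .
  have "(f x)\<^sup>2 * l = (\<integral>y. (f x)\<^sup>2 * indicator {0..l} y \<partial>?M)"
    using ind_int by simp
  also have "\<dots> \<le> (\<integral>y. 2 * (f y)\<^sup>2 + 2 * l * D * indicator {0..l} y \<partial>?M)"
  proof (rule integral_mono)
    show "(f x)\<^sup>2 * indicator {0..l} y \<le> 2 * (f y)\<^sup>2 + 2 * l * D * indicator {0..l} y" for y
      using ptw[of y] by (cases "y \<in> {0..l}") auto
  qed (use ind sq in auto)
  also have "\<dots> = 2 * (\<integral>y. (f y)\<^sup>2 \<partial>?M) + 2 * l * D * l"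
    using ind sq ind_int by simp
  finally have "(f x)\<^sup>2 \<le> (2 * (\<integral>y. (f y)\<^sup>2 \<partial>?M) + 2 * l * D * l) / l"
    using l(1) by (simp add: pos_le_divide_eq)
  also have "\<dots> = 2 / l * (\<integral>y. (f y)\<^sup>2 \<partial>?M) + 2 * l * D"
    using l(1) by (simp add: field_simps)
  finally show ?thesis
    by (simp add: D_def)
qed

lemma finite_common_subsequence:
  assumes "finite A"
    and ex: "\<And>a r. a \<in> A \<Longrightarrow> strict_mono (r :: nat \<Rightarrow> nat) \<Longrightarrow> \<exists>k :: nat \<Rightarrow> nat. strict_mono k \<and> P a (r \<circ> k)"
    and sub: "\<And>a r k. P a r \<Longrightarrow> strict_mono (k :: nat \<Rightarrow> nat) \<Longrightarrow> P a (r \<circ> k)"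
  shows "\<exists>r. strict_mono (r :: nat \<Rightarrow> nat) \<and> (\<forall>a\<in>A. P a r)"
  using assms(1,2)
proof (induction A rule: finite_induct)
  case empty
  show ?case
    by (intro exI[of _ id]) (simp add: strict_mono_def)
next
  case (insert a A)
  then obtain r :: "nat \<Rightarrow> nat" where r: "strict_mono r" "\<forall>a\<in>A. P a r"
    by (metis insertCI)
  obtain k :: "nat \<Rightarrow> nat" where k: "strict_mono k" "P a (r \<circ> k)"
    using insert.prems[OF insertI1 r(1)] by blast
  have "strict_mono (r \<circ> k)"
    using r(1) k(1) by (rule strict_mono_o)
  moreover have "\<forall>b\<in>insert a A. P b (r \<circ> k)"
    using r(2) k sub by blast
  ultimately show ?case
    by blast
qed

locale finite_metric_graph =
  fixes G :: "('v, 'e) metric_graph"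
  assumes finite_edges: "finite (edges G)" and len_pos: "e \<in> edges G \<Longrightarrow> 0 < len G e"
begin

abbreviation "J \<equiv> interval G"

lemma closed_interval_J: "e \<in> edges G \<Longrightarrow> closed_interval (J e)"
  by (intro closed_interval_interval len_pos)

lemma Lq_norm_pow_2_eq_mass: "Lq_norm_pow 2 G u = graph_mass G u"
  unfolding Lq_norm_pow_def graph_mass_def
  by (intro sum.cong refl) (simp add: closed_interval.set_integral_eq[OF closed_interval_J])

lemma Lq_norm_pow_2_graph_deriv: "Lq_norm_pow 2 G (graph_deriv G u) = graph_dirichlet G u"
  by (simp add: Lq_norm_pow_2_eq_mass graph_mass_def graph_dirichlet_def dirichlet_def graph_deriv_def)

lemma segment_length:
  assumes "e \<in> edges G"
  shows "0 < segment_length G e" "{0..segment_length G e} \<subseteq> J e" "0 \<in> J e"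
    "len G e < \<infinity> \<Longrightarrow> {0..segment_length G e} = J e"
  using len_pos[OF assms]
  by (cases "len G e"; auto simp: segment_length_def interval_finite interval_infinite)+

lemma H1D:
  assumes "u \<in> H1 G" "e \<in> edges G"
  shows "u e \<in> H1_on (J e)" "continuous_on (J e) (u e)"
  using assms by (auto simp: H1_def continuous_on_graph_def)

lemma H1_lincomb:
  assumes u: "u \<in> H1 G" and v: "v \<in> H1 G"
  shows "(\<lambda>e x. a * u e x + b * v e x) \<in> H1 G"
proof -
  from u obtain c where c: "\<forall>e\<in>edges G. u e 0 = c (tail (graph G) e) \<and>
        (len G e < \<infinity> \<longrightarrow> u e (real_of_ereal (len G e)) = c (head (graph G) e))"
    by (auto simp: H1_def continuous_on_graph_def)
  from v obtain d where d: "\<forall>e\<in>edges G. v e 0 = d (tail (graph G) e) \<and>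
        (len G e < \<infinity> \<longrightarrow> v e (real_of_ereal (len G e)) = d (head (graph G) e))"
    by (auto simp: H1_def continuous_on_graph_def)
  have "continuous_on (J e) (\<lambda>x. a * u e x + b * v e x)" "(\<lambda>x. a * u e x + b * v e x) \<in> H1_on (J e)"
    if e: "e \<in> edges G" for e
    using H1D[OF u e] H1D[OF v e]
    by (auto intro!: closed_interval.H1_on_lincomb[OF closed_interval_J[OF e]] continuous_intros)
  moreover have "\<forall>e\<in>edges G. a * u e 0 + b * v e 0 = a * c (tail (graph G) e) + b * d (tail (graph G) e) \<and>
        (len G e < \<infinity> \<longrightarrow> a * u e (real_of_ereal (len G e)) + b * v e (real_of_ereal (len G e)) =
          a * c (head (graph G) e) + b * d (head (graph G) e))"
    using c d by auto
  ultimately show ?thesis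
    unfolding H1_def continuous_on_graph_def
    by (intro CollectI conjI ballI exI[of _ "\<lambda>x. a * c x + b * d x"]) auto
qed

lemma H1_cmult: "u \<in> H1 G \<Longrightarrow> (\<lambda>e x. a * u e x) \<in> H1 G"
  using H1_lincomb[of u u a 0] by simp

lemma graph_dirichlet_cmult: "u \<in> H1 G \<Longrightarrow> graph_dirichlet G (\<lambda>e x. a * u e x) = a\<^sup>2 * graph_dirichlet G u"
  unfolding graph_dirichlet_def sum_distrib_left
  by (intro sum.cong refl closed_interval.dirichlet_cmult closed_interval_J H1D)

lemma graph_mass_cmult: "graph_mass G (\<lambda>e x. a * u e x) = a\<^sup>2 * graph_mass G u"
  by (simp add: graph_mass_def sum_distrib_left power_mult_distrib)

lemma graph_dirichlet_parallelogram:
  assumes "u \<in> H1 G" "v \<in> H1 G"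
  shows "graph_dirichlet G (\<lambda>e x. 1/2 * u e x + 1/2 * v e x) + 1/4 * graph_dirichlet G (\<lambda>e x. u e x - v e x) =
    1/2 * graph_dirichlet G u + 1/2 * graph_dirichlet G v"
  unfolding graph_dirichlet_def sum_distrib_left sum.distrib[symmetric]
  by (intro sum.cong refl closed_interval.dirichlet_parallelogram closed_interval_J H1D assms)

lemma graph_mass_midpoint:
  assumes u: "u \<in> H1 G" and v: "v \<in> H1 G"
  shows "graph_mass G (\<lambda>e x. 1/2 * u e x + 1/2 * v e x) \<le> 1/2 * graph_mass G u + 1/2 * graph_mass G v"
  unfolding graph_mass_def sum_distrib_left sum.distrib[symmetric]
proof (rule sum_mono)
  fix e assume e: "e \<in> edges G"
  interpret closed_interval "J e"
    by (rule closed_interval_J[OF e])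
  note s = H1_onD(1)[OF H1D(1)[OF u e]] H1_onD(1)[OF H1D(1)[OF v e]]
  have "0 \<le> (\<integral>x. (1/2 * u e x + (-1/2) * v e x)\<^sup>2 \<partial>lebesgue_on (J e))"
    by simp
  then show "(\<integral>x. (1/2 * u e x + 1/2 * v e x)\<^sup>2 \<partial>lebesgue_on (J e)) \<le>
      1/2 * (\<integral>x. (u e x)\<^sup>2 \<partial>lebesgue_on (J e)) + 1/2 * (\<integral>x. (v e x)\<^sup>2 \<partial>lebesgue_on (J e))"
    unfolding integral_square_lincomb[OF s] by (simp add: power2_eq_square)
qed

lemma dirichlet_le: "e \<in> edges G \<Longrightarrow> dirichlet (J e) (u e) \<le> graph_dirichlet G u"
  unfolding graph_dirichlet_def
  by (rule member_le_sum) (auto simp: finite_edges dirichlet_nonneg)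

lemma mass_le: "e \<in> edges G \<Longrightarrow> (\<integral>x. (u e x)\<^sup>2 \<partial>lebesgue_on (J e)) \<le> graph_mass G u"
  unfolding graph_mass_def
  by (rule member_le_sum[where f = "\<lambda>e. \<integral>x. (u e x)\<^sup>2 \<partial>lebesgue_on (J e)"]) (auto simp: finite_edges)

lemma increment_bound:
  assumes "u \<in> H1 G" "e \<in> edges G" "x \<in> J e" "y \<in> J e"
  shows "(u e y - u e x)\<^sup>2 \<le> \<bar>y - x\<bar> * graph_dirichlet G u"
  by (rule order_trans[OF closed_interval.dirichlet_increment_bound[OF closed_interval_J[OF assms(2)]
      H1D(2,1)[OF assms(1,2)] assms(3,4)]])
    (intro mult_left_mono dirichlet_le assms abs_ge_zero)

lemma sup_bound:
  assumes u: "u \<in> H1 G" and e: "e \<in> edges G" and x: "x \<in> {0..segment_length G e}"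
  shows "(u e x)\<^sup>2 \<le> 2 / segment_length G e * graph_mass G u + 2 * segment_length G e * graph_dirichlet G u"
proof -
  have "(u e x)\<^sup>2 \<le> 2 / segment_length G e * (\<integral>x. (u e x)\<^sup>2 \<partial>lebesgue_on (J e)) +
      2 * segment_length G e * dirichlet (J e) (u e)"
    by (rule closed_interval.H1_on_sup_bound[OF closed_interval_J[OF e] H1D[OF u e] segment_length(1,2)[OF e] x])
  also have "\<dots> \<le> 2 / segment_length G e * graph_mass G u + 2 * segment_length G e * graph_dirichlet G u"
    using segment_length(1)[OF e] by (intro add_mono mult_left_mono mass_le dirichlet_le e) auto
  finally show ?thesis .
qed

text \<open>
Bounded mass and Dirichlet integral give uniform bounds and, by the Hoelder estimate, equicontinuity on
the initial segments. The Arzela-Ascoli theorem is applied to one edge after the other.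
\<close>

lemma H1_compactness:
  assumes u: "\<And>n. u n \<in> H1 G" and D: "\<And>n. graph_dirichlet G (u n) \<le> D" and m: "\<And>n. graph_mass G (u n) \<le> m"
  shows "\<exists>r :: nat \<Rightarrow> nat. strict_mono r \<and>
    (\<forall>e\<in>edges G. \<exists>g. uniform_limit {0..segment_length G e} (\<lambda>n. u (r n) e) g sequentially)"
proof (rule finite_common_subsequence[where P = "\<lambda>e r. \<exists>g. uniform_limit {0..segment_length G e} (\<lambda>n. u (r n) e) g sequentially"])
  show "finite (edges G)"
    by (rule finite_edges)
  show "\<exists>g. uniform_limit {0..segment_length G e} (\<lambda>n. u ((r \<circ> k) n) e) g sequentially"
    if "\<exists>g. uniform_limit {0..segment_length G e} (\<lambda>n. u (r n) e) g sequentially" "strict_mono k" for e and r k :: "nat \<Rightarrow> nat"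
  proof -
    from that(1) obtain g where "uniform_limit {0..segment_length G e} (\<lambda>n. u (r n) e) g sequentially" ..
    from filterlim_compose[OF this filterlim_subseq[OF that(2)]] show ?thesis
      by (auto simp: o_def)
  qed
next
  fix e and r :: "nat \<Rightarrow> nat" assume e: "e \<in> edges G"
  define l where "l = segment_length G e"
  note l = segment_length(1,2)[OF e, folded l_def]
  have D0: "D \<ge> 0"
    using D[of 0] graph_dirichlet_nonneg[of G "u 0"] by linarith
  have incr: "(u n e y - u n e x)\<^sup>2 \<le> \<bar>y - x\<bar> * D" if "x \<in> {0..l}" "y \<in> {0..l}" for n x y
    by (rule order_trans[OF increment_bound[OF u e]])
      (use that l D in \<open>auto intro: mult_left_mono\<close>)
  have bound: "norm (u n e x) \<le> sqrt (2 / l * m + 2 * l * D)" if "x \<in> {0..l}" for n x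
  proof -
    have "(u n e x)\<^sup>2 \<le> 2 / l * graph_mass G (u n) + 2 * l * graph_dirichlet G (u n)"
      using sup_bound[OF u e, of x n] that by (simp add: l_def)
    also have "\<dots> \<le> 2 / l * m + 2 * l * D"
      using l(1) by (intro add_mono mult_left_mono D m) auto
    finally show ?thesis
      by (intro real_le_rsqrt) simp
  qed
  obtain g k where k: "strict_mono (k :: nat \<Rightarrow> nat)"
    and g: "\<And>\<epsilon>. 0 < \<epsilon> \<Longrightarrow> \<exists>N. \<forall>n x. n \<ge> N \<and> x \<in> {0..l} \<longrightarrow> norm (u (r (k n)) e x - g x) < \<epsilon>"
  proof (rule Arzela_Ascoli[of "{0..l}" "\<lambda>n. u (r n) e" "sqrt (2 / l * m + 2 * l * D)"])
    show "\<exists>d>0. \<forall>n y. y \<in> {0..l} \<and> norm (x - y) < d \<longrightarrow> norm (u (r n) e x - u (r n) e y) < \<epsilon>"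
      if x: "x \<in> {0..l}" and \<epsilon>: "0 < \<epsilon>" for x \<epsilon>
    proof (intro exI conjI allI impI)
      show "0 < \<epsilon>\<^sup>2 / (D + 1)"
        using \<epsilon> D0 by simp
      fix n y assume y: "y \<in> {0..l} \<and> norm (x - y) < \<epsilon>\<^sup>2 / (D + 1)"
      have "\<bar>u (r n) e x - u (r n) e y\<bar>\<^sup>2 \<le> \<bar>x - y\<bar> * D"
        using incr[of y x "r n"] x y by simp
      also have "\<dots> \<le> \<bar>x - y\<bar> * (D + 1)"
        by (intro mult_left_mono) auto
      also have "\<dots> < \<epsilon>\<^sup>2"
        using y D0 by (simp add: pos_less_divide_eq)
      finally show "norm (u (r n) e x - u (r n) e y) < \<epsilon>"
        using \<epsilon> power2_less_imp_less[of "\<bar>u (r n) e x - u (r n) e y\<bar>" \<epsilon>] by simp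
    qed
  qed (use bound in auto)
  have "uniform_limit {0..l} (\<lambda>n. u ((r \<circ> k) n) e) g sequentially"
    unfolding uniform_limit_iff eventually_sequentially dist_real_def
    using g by (metis comp_apply real_norm_def)
  with k show "\<exists>k. strict_mono k \<and> (\<exists>g. uniform_limit {0..segment_length G e} (\<lambda>n. u ((r \<circ> k) n) e) g sequentially)"
    by (auto simp: l_def)
qed

text \<open>
The vertex conditions are closed under pointwise convergence. The Dirichlet integral converges, because the
derivatives do so in \<open>L\<^sup>2\<close>; the mass is only lower semicontinuous, as part of it may escape along the
half-lines.
\<close>

lemma H1_limit:
  assumes u: "\<And>n. u n \<in> H1 G" and m: "\<And>n. graph_mass G (u n) \<le> m"
    and rapid: "\<And>n k. n \<le> k \<Longrightarrow> graph_dirichlet G (\<lambda>e x. u k e x - u n e x) \<le> (1/4) ^ n"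
    and start: "\<And>e. e \<in> edges G \<Longrightarrow> convergent (\<lambda>n. u n e 0)"
  obtains w where "w \<in> H1 G" "\<And>e x. e \<in> edges G \<Longrightarrow> x \<in> J e \<Longrightarrow> (\<lambda>n. u n e x) \<longlonglongrightarrow> w e x"
    "(\<lambda>n. graph_dirichlet G (u n)) \<longlonglongrightarrow> graph_dirichlet G w" "graph_mass G w \<le> m"
proof -
  define P where "P e h \<longleftrightarrow> h \<in> H1_on (J e) \<and> continuous_on (J e) h \<and> (\<forall>x\<in>J e. (\<lambda>n. u n e x) \<longlonglongrightarrow> h x) \<and>
    (\<lambda>n. dirichlet (J e) (u n e)) \<longlonglongrightarrow> dirichlet (J e) h \<and>
    (\<forall>c. c < (\<integral>x. (h x)\<^sup>2 \<partial>lebesgue_on (J e)) \<longrightarrow>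
      eventually (\<lambda>n. c < (\<integral>x. (u n e x)\<^sup>2 \<partial>lebesgue_on (J e))) sequentially)" for e h
  have "\<exists>h. P e h"
    if e: "e \<in> edges G" for e
  proof -
    interpret closed_interval "J e"
      by (rule closed_interval_J[OF e])
    have r: "dirichlet (J e) (\<lambda>x. u k e x - u n e x) \<le> (1/4) ^ n" if "n \<le> k" for n k
      using dirichlet_le[OF e, of "\<lambda>e x. u k e x - u n e x"] rapid[OF that] by simp
    show ?thesis
      unfolding P_def
      by (rule H1_on_limit[OF H1D(1)[OF u e] H1D(2)[OF u e] r segment_length(3)[OF e] start[OF e]
          order_trans[OF mass_le[OF e] m]]) blast+
  qed
  then have "\<forall>e\<in>edges G. \<exists>h. P e h"
    by blast
  from bchoice[OF this] obtain w where Pw: "\<And>e. e \<in> edges G \<Longrightarrow> P e (w e)"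
    by blast
  have w: "\<And>e. e \<in> edges G \<Longrightarrow> w e \<in> H1_on (J e)" "\<And>e. e \<in> edges G \<Longrightarrow> continuous_on (J e) (w e)"
    and lim: "\<And>e x. e \<in> edges G \<Longrightarrow> x \<in> J e \<Longrightarrow> (\<lambda>n. u n e x) \<longlonglongrightarrow> w e x"
    and D: "\<And>e. e \<in> edges G \<Longrightarrow> (\<lambda>n. dirichlet (J e) (u n e)) \<longlonglongrightarrow> dirichlet (J e) (w e)"
    and lsc: "\<And>e c. e \<in> edges G \<Longrightarrow> c < (\<integral>x. (w e x)\<^sup>2 \<partial>lebesgue_on (J e)) \<Longrightarrow>
      eventually (\<lambda>n. c < (\<integral>x. (u n e x)\<^sup>2 \<partial>lebesgue_on (J e))) sequentially"
    using Pw unfolding P_def by blast+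
  have "\<forall>n. \<exists>c. \<forall>e\<in>edges G. u n e 0 = c (tail (graph G) e) \<and>
      (len G e < \<infinity> \<longrightarrow> u n e (real_of_ereal (len G e)) = c (head (graph G) e))"
    using u by (simp add: H1_def continuous_on_graph_def)
  from choice[OF this] obtain c where
    c: "\<And>n e. e \<in> edges G \<Longrightarrow> u n e 0 = c n (tail (graph G) e)"
      "\<And>n e. e \<in> edges G \<Longrightarrow> len G e < \<infinity> \<Longrightarrow> u n e (real_of_ereal (len G e)) = c n (head (graph G) e)"
    by blast
  have "w \<in> H1 G"
    unfolding H1_def continuous_on_graph_def
  \<comment> \<open>The vertex values converge at every end of an edge; at a vertex at infinity the limit is a default
    value.\<close>
  proof (intro CollectI conjI ballI exI[of _ "\<lambda>v. lim (\<lambda>n. c n v)"] impI w)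
    fix e assume e: "e \<in> edges G"
    have "(\<lambda>n. c n (tail (graph G) e)) \<longlonglongrightarrow> w e 0"
      using lim[OF e segment_length(3)[OF e]] by (simp add: c e)
    then show "w e 0 = lim (\<lambda>n. c n (tail (graph G) e))"
      by (rule limI[symmetric])
    assume fin: "len G e < \<infinity>"
    have "segment_length G e \<in> J e"
      using segment_length(1,2)[OF e] by (auto intro: less_imp_le)
    then have "(\<lambda>n. c n (head (graph G) e)) \<longlonglongrightarrow> w e (real_of_ereal (len G e))"
      using lim[OF e, of "segment_length G e"] fin by (simp add: segment_length_def c(2)[OF e fin])
    then show "w e (real_of_ereal (len G e)) = lim (\<lambda>n. c n (head (graph G) e))"
      by (rule limI[symmetric])
  qed
  moreover have "(\<lambda>n. graph_dirichlet G (u n)) \<longlonglongrightarrow> graph_dirichlet G w"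
    unfolding graph_dirichlet_def by (intro tendsto_sum D)
  moreover have "graph_mass G w \<le> m"
  proof (rule field_le_epsilon)
    fix \<epsilon> :: real assume "\<epsilon> > 0"
    define \<delta> where "\<delta> = \<epsilon> / (real (card (edges G)) + 1)"
    have \<delta>: "\<delta> > 0" "real (card (edges G)) * \<delta> \<le> \<epsilon>"
      using \<open>\<epsilon> > 0\<close> by (auto simp: \<delta>_def field_simps)
    have "eventually (\<lambda>n. \<forall>e\<in>edges G. (\<integral>x. (w e x)\<^sup>2 \<partial>lebesgue_on (J e)) - \<delta> <
        (\<integral>x. (u n e x)\<^sup>2 \<partial>lebesgue_on (J e))) sequentially"
      using \<delta>(1) by (intro eventually_ball_finite finite_edges ballI lsc) auto
    then obtain n where n: "\<And>e. e \<in> edges G \<Longrightarrow> (\<integral>x. (w e x)\<^sup>2 \<partial>lebesgue_on (J e)) - \<delta> <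
        (\<integral>x. (u n e x)\<^sup>2 \<partial>lebesgue_on (J e))"
      by (auto simp: eventually_sequentially)
    have "graph_mass G w - real (card (edges G)) * \<delta> = (\<Sum>e\<in>edges G. (\<integral>x. (w e x)\<^sup>2 \<partial>lebesgue_on (J e)) - \<delta>)"
      by (simp add: graph_mass_def sum_subtractf)
    also have "\<dots> \<le> graph_mass G (u n)"
      unfolding graph_mass_def by (intro sum_mono less_imp_le n)
    finally show "graph_mass G w \<le> m + \<epsilon>"
      using \<delta>(2) m[of n] by linarith
  qed
  ultimately show thesis
    using that lim by blast
qed

end

section \<open>Coercivity of the energy\<close>

text \<open>
Beyond the point \<open>X\<close> where \<open>x\<^sup>a = \<eta> x\<close>, the sublinear power lies below the line \<open>\<eta> x\<close>; before it, it is at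
most \<open>X\<^sup>a\<close>.
\<close>

lemma powr_le_linear:
  fixes a \<eta> :: real
  assumes "0 < a" "a < 1" "0 < \<eta>"
  obtains C where "0 \<le> C" "\<And>x. 0 \<le> x \<Longrightarrow> x powr a \<le> \<eta> * x + C"
proof -
  define X where "X = \<eta> powr (1 / (a - 1))"
  have X: "X > 0" "X powr (a - 1) = \<eta>"
    using assms by (auto simp: X_def powr_powr)
  show thesis
  proof (rule that[of "X powr a"])
    fix x :: real assume x: "0 \<le> x"
    show "x powr a \<le> \<eta> * x + X powr a"
    proof (cases "x \<le> X")
      case True
      then have "x powr a \<le> X powr a"
        using x assms by (intro powr_mono2) auto
      then show ?thesis
        using x assms by (simp add: add_increasing)
    next
      case False
      then have "x powr (a - 1) \<le> X powr (a - 1)"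
        using X assms by (intro powr_mono2') auto
      then have "x powr (a - 1) * x \<le> \<eta> * x"
        using x X by (intro mult_right_mono) auto
      also have "x powr (a - 1) * x = x powr (a - 1) * x powr 1"
        using x by simp
      also have "\<dots> = x powr a"
        by (subst powr_add[symmetric]) simp
      finally show ?thesis
        by (simp add: add_increasing2)
    qed
  qed simp
qed

lemma integrable_continuous_Icc:
  fixes f :: "real \<Rightarrow> real"
  assumes "continuous_on {a..b} f"
  shows "integrable (lebesgue_on {a..b}) f"
  using absolutely_integrable_continuous_real[OF assms]
  by (simp add: integrable_restrict_space set_integrable_def)

lemma sq_integrable_continuous_Icc:
  fixes f :: "real \<Rightarrow> real"
  assumes "continuous_on {a..b} f"
  shows "sq_integrable (lebesgue_on {a..b}) f"
  using integrable_continuous_Icc[OF assms] integrable_continuous_Icc[of a b "\<lambda>x. (f x)\<^sup>2"] assms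
  by (auto simp: sq_integrable_def intro!: continuous_intros)

lemma continuous_on_abs_powr:
  fixes f :: "real \<Rightarrow> real"
  assumes "continuous_on A f" "q > 0"
  shows "continuous_on A (\<lambda>x. \<bar>f x\<bar> powr q)"
  using assms by (intro continuous_on_powr' continuous_intros) auto

lemma integral_const_Icc: "0 \<le> l \<Longrightarrow> (\<integral>x. c \<partial>lebesgue_on {0..l}) = l * (c :: real)"
  by (simp add: measure_restrict_space)

lemma integral_powr_le:
  fixes f :: "real \<Rightarrow> real"
  assumes f: "continuous_on {0..l} f" and p: "p > 2" and X: "\<And>x. x \<in> {0..l} \<Longrightarrow> (f x)\<^sup>2 \<le> X"
  shows "(\<integral>x. \<bar>f x\<bar> powr p \<partial>lebesgue_on {0..l}) \<le> X powr ((p - 2) / 2) * (\<integral>x. (f x)\<^sup>2 \<partial>lebesgue_on {0..l})"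
proof -
  have "\<bar>f x\<bar> powr p \<le> X powr ((p - 2) / 2) * (f x)\<^sup>2" if "x \<in> {0..l}" for x
  proof -
    have "\<bar>f x\<bar> powr p = \<bar>f x\<bar> powr (p - 2) * \<bar>f x\<bar> powr 2"
      by (subst powr_add[symmetric]) simp
    also have "\<bar>f x\<bar> powr (p - 2) = (\<bar>f x\<bar> powr 2) powr ((p - 2) / 2)"
      unfolding powr_powr by (rule arg_cong[of _ _ "(powr) \<bar>f x\<bar>"]) (simp add: field_simps)
    also have "\<dots> * \<bar>f x\<bar> powr 2 \<le> X powr ((p - 2) / 2) * \<bar>f x\<bar> powr 2"
      using X[OF that] p by (intro mult_right_mono powr_mono2) auto
    finally show ?thesis
      by simp
  qed
  then have "(\<integral>x. \<bar>f x\<bar> powr p \<partial>lebesgue_on {0..l}) \<le> (\<integral>x. X powr ((p - 2) / 2) * (f x)\<^sup>2 \<partial>lebesgue_on {0..l})"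
    using p f by (intro integral_mono integrable_continuous_Icc continuous_on_abs_powr continuous_intros) auto
  then show ?thesis
    by simp
qed

lemma exp_decay_integral:
  assumes "a > 0"
  shows "integrable (lebesgue_on {0..}) (\<lambda>x::real. exp (- a * x))" "(\<integral>x. exp (- a * x) \<partial>lebesgue_on {0..}) = 1 / a"
proof -
  have hi: "((\<lambda>x::real. exp (- a * x)) has_integral 1 / a) {0..}"
    using has_integral_exp_minus_to_infinity[OF assms, of 0] by simp
  then have ai: "(\<lambda>x::real. exp (- a * x)) absolutely_integrable_on {0..}"
    by (intro nonnegative_absolutely_integrable_1 has_integral_integrable) auto
  then show "integrable (lebesgue_on {0..}) (\<lambda>x::real. exp (- a * x))"
    by (simp add: integrable_restrict_space set_integrable_def)
  show "(\<integral>x. exp (- a * x) \<partial>lebesgue_on {0..}) = 1 / a"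
    using set_lebesgue_integral_eq_integral(2)[OF ai] integral_unique[OF hi]
    by (simp add: integral_restrict_space set_lebesgue_integral_def)
qed

locale half_line_graph =
  fixes K :: "('v, 'e) metric_graph" and N :: nat and s :: "nat \<Rightarrow> 'v" and p :: real
  assumes K: "compact_metric_graph K" and p: "2 < p" "p < 4"
begin

abbreviation "G \<equiv> attach_half_lines K N s"

lemma edges_G: "edges G = Inl ` edges K \<union> Inr ` {..<N}"
  and len_Inl: "len G (Inl e) = len K e"
  and len_Inr: "len G (Inr i) = \<infinity>"
  by (auto simp: attach_half_lines_def)

lemma finite_edges_K: "finite (edges K)"
  using K fin_digraph.finite_arcs by (auto simp: compact_metric_graph_def)

definition L :: "'e \<Rightarrow> real" where
  "L e = real_of_ereal (len K e)"

lemma L: "e \<in> edges K \<Longrightarrow> 0 < L e \<and> len K e = ereal (L e)"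
  using K by (cases "len K e") (auto simp: compact_metric_graph_def L_def)

sublocale finite_metric_graph G
proof
  show "finite (edges G)"
    by (simp add: edges_G finite_edges_K)
  show "0 < len G e" if "e \<in> edges G" for e
    using that K by (auto simp: edges_G len_Inl len_Inr compact_metric_graph_def)
qed

lemma interval_K: "e \<in> edges K \<Longrightarrow> interval K e = {0..L e}"
  and interval_Inl: "e \<in> edges K \<Longrightarrow> J (Inl e) = {0..L e}"
  and interval_Inr: "J (Inr i) = {0..}"
  and segment_length_Inl: "e \<in> edges K \<Longrightarrow> segment_length G (Inl e) = L e"
  using L by (auto simp: interval_finite interval_infinite len_Inl len_Inr segment_length_def)

definition nonlin :: "('e + nat \<Rightarrow> real \<Rightarrow> real) \<Rightarrow> real" where
  "nonlin u = (\<Sum>e\<in>edges K. \<integral>x. \<bar>u (Inl e) x\<bar> powr p \<partial>lebesgue_on {0..L e})"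

abbreviation E :: "('e + nat \<Rightarrow> real \<Rightarrow> real) \<Rightarrow> real" where
  "E \<equiv> energy p K N s"

lemma energy_eq: "E u = 1 / 2 * graph_dirichlet G u - 1 / p * nonlin u"
proof -
  have "Lq_norm_pow p K (\<lambda>e. u (Inl e)) = nonlin u"
    unfolding Lq_norm_pow_def nonlin_def
    by (intro sum.cong refl) (simp add: interval_K set_lebesgue_integral_def integral_restrict_space)
  then show ?thesis
    by (simp add: energy_def Lq_norm_pow_2_graph_deriv)
qed

lemma H1_mass_eq: "H1_mass m G = {u \<in> H1 G. graph_mass G u = m}"
  by (simp add: H1_mass_def Lq_norm_pow_2_eq_mass)

lemma continuous_Inl: "u \<in> H1 G \<Longrightarrow> e \<in> edges K \<Longrightarrow> continuous_on {0..L e} (u (Inl e))"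
  using H1D(2)[of u "Inl e"] by (simp add: edges_G interval_Inl)

lemma sup_bound_Inl:
  assumes "u \<in> H1 G" "e \<in> edges K" "x \<in> {0..L e}"
  shows "(u (Inl e) x)\<^sup>2 \<le> 2 / L e * graph_mass G u + 2 * L e * graph_dirichlet G u"
  using sup_bound[OF assms(1), of "Inl e" x] assms by (simp add: edges_G segment_length_Inl)

text \<open>
One factor \<open>u\<^sup>2\<close> of \<open>\<bar>u\<bar>\<^sup>p\<close> is kept for the mass, the remaining power \<open>p - 2\<close> is estimated by the supremum.
\<close>

lemma edge_nonlin_le:
  assumes u: "u \<in> H1 G" and e: "e \<in> edges K"
  shows "(\<integral>x. \<bar>u (Inl e) x\<bar> powr p \<partial>lebesgue_on {0..L e}) \<le>
    (2 / L e * graph_mass G u + 2 * L e * graph_dirichlet G u) powr ((p - 2) / 2) * graph_mass G u"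
proof -
  have "(\<integral>x. \<bar>u (Inl e) x\<bar> powr p \<partial>lebesgue_on {0..L e}) \<le>
    (2 / L e * graph_mass G u + 2 * L e * graph_dirichlet G u) powr ((p - 2) / 2) *
      (\<integral>x. (u (Inl e) x)\<^sup>2 \<partial>lebesgue_on {0..L e})"
    by (intro integral_powr_le continuous_Inl u e p sup_bound_Inl)
  also have "(\<integral>x. (u (Inl e) x)\<^sup>2 \<partial>lebesgue_on {0..L e}) \<le> graph_mass G u"
    using mass_le[of "Inl e" u] e by (simp add: edges_G interval_Inl)
  finally show ?thesis
    by (simp add: mult_left_mono)
qed

text \<open>
The exponent \<open>(p - 2) / 2\<close> of the Dirichlet integral in the preceding bound is less than \<open>1\<close>, so the
nonlinear term can be absorbed with an arbitrarily small factor.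
\<close>

lemma coercive:
  assumes \<mu>: "\<mu> > 0"
  obtains C where "\<And>u. u \<in> H1 G \<Longrightarrow> graph_mass G u \<le> \<mu> \<Longrightarrow> graph_dirichlet G u \<le> 4 * E u + C"
proof -
  \<comment> \<open>With this factor on each edge the nonlinear part of the energy absorbs at most a quarter of \<open>D
    u\<close>; adding \<open>1\<close> avoids a division by \<open>0\<close>.\<close>
  define \<eta> where "\<eta> = p / (4 * (real (card (edges K)) + 1))"
  have \<eta>: "\<eta> > 0" "real (card (edges K)) * \<eta> \<le> p / 4"
    using p by (auto simp: \<eta>_def field_simps)
  have "\<exists>C. \<forall>u\<in>H1 G. graph_mass G u \<le> \<mu> \<longrightarrow>
      (\<integral>x. \<bar>u (Inl e) x\<bar> powr p \<partial>lebesgue_on {0..L e}) \<le> \<eta> * graph_dirichlet G u + C" if e: "e \<in> edges K" for e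
  proof -
    define a where "a = (p - 2) / 2"
    define l where "l = L e"
    have a: "0 < a" "a < 1" and l: "l > 0"
      using p L[OF e] by (auto simp: a_def l_def)
    \<comment> \<open>The slope for which the term \<open>2 l D\<close> below contributes exactly \<open>\<eta> D\<close> after
      multiplication by \<open>\<mu>\<close>.\<close>
    have "\<eta> / (2 * l * \<mu>) > 0"
      using \<eta> l \<mu> by simp
    from powr_le_linear[OF a this] obtain C where
      C: "0 \<le> C" "\<And>x. 0 \<le> x \<Longrightarrow> x powr a \<le> \<eta> / (2 * l * \<mu>) * x + C"
      by blast
    have "(\<integral>x. \<bar>u (Inl e) x\<bar> powr p \<partial>lebesgue_on {0..L e}) \<le>
        \<eta> * graph_dirichlet G u + (\<eta> * \<mu> / l\<^sup>2 + C * \<mu>)"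
      if u: "u \<in> H1 G" "graph_mass G u \<le> \<mu>" for u
    proof -
      define D where "D = graph_dirichlet G u"
      define m where "m = graph_mass G u"
      have D0: "D \<ge> 0" and m: "0 \<le> m" "m \<le> \<mu>"
        using u graph_dirichlet_nonneg graph_mass_nonneg by (auto simp: D_def m_def)
      have "(\<integral>x. \<bar>u (Inl e) x\<bar> powr p \<partial>lebesgue_on {0..L e}) \<le> (2 / l * m + 2 * l * D) powr a * m"
        using edge_nonlin_le[OF u(1) e] by (simp add: D_def m_def a_def l_def)
      also have "\<dots> \<le> (2 / l * \<mu> + 2 * l * D) powr a * \<mu>"
        using m D0 l a by (intro mult_mono powr_mono2 add_mono mult_left_mono) auto
      also have "\<dots> \<le> (\<eta> / (2 * l * \<mu>) * (2 / l * \<mu> + 2 * l * D) + C) * \<mu>"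
        using \<mu> l D0 by (intro mult_right_mono C) auto
      also have "\<dots> = \<eta> * D + (\<eta> * \<mu> / l\<^sup>2 + C * \<mu>)"
        using \<mu> l by (simp add: field_simps power2_eq_square)
      finally show ?thesis
        by (simp add: D_def)
    qed
    then show ?thesis
      by blast
  qed
  then have "\<forall>e\<in>edges K. \<exists>C. \<forall>u\<in>H1 G. graph_mass G u \<le> \<mu> \<longrightarrow>
      (\<integral>x. \<bar>u (Inl e) x\<bar> powr p \<partial>lebesgue_on {0..L e}) \<le> \<eta> * graph_dirichlet G u + C"
    by blast
  from bchoice[OF this] obtain C where C: "\<And>e u. e \<in> edges K \<Longrightarrow> u \<in> H1 G \<Longrightarrow> graph_mass G u \<le> \<mu> \<Longrightarrow>
      (\<integral>x. \<bar>u (Inl e) x\<bar> powr p \<partial>lebesgue_on {0..L e}) \<le> \<eta> * graph_dirichlet G u + C e"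
    by blast
  show thesis
  proof (rule that[of "4 / p * (\<Sum>e\<in>edges K. C e)"])
    fix u assume u: "u \<in> H1 G" "graph_mass G u \<le> \<mu>"
    have "nonlin u \<le> (\<Sum>e\<in>edges K. \<eta> * graph_dirichlet G u + C e)"
      unfolding nonlin_def by (intro sum_mono C u)
    also have "\<dots> = real (card (edges K)) * \<eta> * graph_dirichlet G u + (\<Sum>e\<in>edges K. C e)"
      by (simp add: sum.distrib)
    also have "\<dots> \<le> p / 4 * graph_dirichlet G u + (\<Sum>e\<in>edges K. C e)"
      using \<eta> by (intro add_right_mono mult_right_mono graph_dirichlet_nonneg)
    finally have "1 / p * nonlin u \<le> 1 / p * (p / 4 * graph_dirichlet G u + (\<Sum>e\<in>edges K. C e))"
      using p by (intro mult_left_mono) auto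
    also have "\<dots> = graph_dirichlet G u / 4 + 1 / p * (\<Sum>e\<in>edges K. C e)"
      using p by (simp add: field_simps)
    finally show "graph_dirichlet G u \<le> 4 * E u + 4 / p * (\<Sum>e\<in>edges K. C e)"
      by (simp add: energy_eq)
  qed
qed

lemma nonlin_nonneg: "0 \<le> nonlin u"
  by (simp add: nonlin_def sum_nonneg)

lemma nonlin_cmult: "c \<ge> 0 \<Longrightarrow> nonlin (\<lambda>e x. c * u e x) = c powr p * nonlin u"
  by (simp add: nonlin_def sum_distrib_left abs_mult powr_mult)

lemma nonlin_uniformly_continuous:
  assumes "\<epsilon> > 0"
  obtains \<delta> where "\<delta> > 0" "\<And>u v. u \<in> H1 G \<Longrightarrow> v \<in> H1 G \<Longrightarrow>
    (\<And>e x. e \<in> edges K \<Longrightarrow> x \<in> {0..L e} \<Longrightarrow> \<bar>u (Inl e) x\<bar> \<le> M \<and> \<bar>v (Inl e) x\<bar> \<le> M \<and> \<bar>u (Inl e) x - v (Inl e) x\<bar> < \<delta>) \<Longrightarrow>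
    \<bar>nonlin u - nonlin v\<bar> \<le> \<epsilon>"
proof -
  define \<Lambda> where "\<Lambda> = (\<Sum>e\<in>edges K. L e)"
  have \<Lambda>: "\<Lambda> \<ge> 0"
    unfolding \<Lambda>_def using L by (intro sum_nonneg) (auto intro: less_imp_le)
  define \<epsilon>' where "\<epsilon>' = \<epsilon> / (\<Lambda> + 1)"
  have \<epsilon>': "\<epsilon>' > 0" "\<Lambda> * \<epsilon>' \<le> \<epsilon>"
    using assms \<Lambda> by (auto simp: \<epsilon>'_def field_simps)
  have "uniformly_continuous_on {-M..M} (\<lambda>t. \<bar>t\<bar> powr p)"
    using p by (intro compact_uniformly_continuous continuous_on_abs_powr continuous_on_id) auto
  then obtain \<delta> where \<delta>: "\<delta> > 0"
    "\<And>s t. s \<in> {-M..M} \<Longrightarrow> t \<in> {-M..M} \<Longrightarrow> \<bar>s - t\<bar> < \<delta> \<Longrightarrow> \<bar>\<bar>s\<bar> powr p - \<bar>t\<bar> powr p\<bar> < \<epsilon>'"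
    using \<epsilon>'(1) unfolding uniformly_continuous_on_def dist_real_def by metis
  show thesis
  proof (rule that[OF \<delta>(1)])
    fix u v
    assume u: "u \<in> H1 G" and v: "v \<in> H1 G"
      and close: "\<And>e x. e \<in> edges K \<Longrightarrow> x \<in> {0..L e} \<Longrightarrow>
        \<bar>u (Inl e) x\<bar> \<le> M \<and> \<bar>v (Inl e) x\<bar> \<le> M \<and> \<bar>u (Inl e) x - v (Inl e) x\<bar> < \<delta>"
    have "\<bar>nonlin u - nonlin v\<bar> \<le> (\<Sum>e\<in>edges K. \<bar>(\<integral>x. \<bar>u (Inl e) x\<bar> powr p \<partial>lebesgue_on {0..L e}) -
        (\<integral>x. \<bar>v (Inl e) x\<bar> powr p \<partial>lebesgue_on {0..L e})\<bar>)"
      unfolding nonlin_def sum_subtractf[symmetric] by (rule sum_abs)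
    also have "\<dots> \<le> (\<Sum>e\<in>edges K. L e * \<epsilon>')"
    proof (rule sum_mono)
      fix e assume e: "e \<in> edges K"
      let ?M = "lebesgue_on {0..L e}"
      have i: "integrable ?M (\<lambda>x. \<bar>u (Inl e) x\<bar> powr p)" "integrable ?M (\<lambda>x. \<bar>v (Inl e) x\<bar> powr p)"
        using p by (intro integrable_continuous_Icc continuous_on_abs_powr continuous_Inl u v e; simp)+
      have "\<bar>(\<integral>x. \<bar>u (Inl e) x\<bar> powr p \<partial>?M) - (\<integral>x. \<bar>v (Inl e) x\<bar> powr p \<partial>?M)\<bar> =
          \<bar>\<integral>x. \<bar>u (Inl e) x\<bar> powr p - \<bar>v (Inl e) x\<bar> powr p \<partial>?M\<bar>"
        using i by simp
      also have "\<dots> \<le> (\<integral>x. \<bar>\<bar>u (Inl e) x\<bar> powr p - \<bar>v (Inl e) x\<bar> powr p\<bar> \<partial>?M)"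
        by (rule integral_abs_bound)
      also have "\<dots> \<le> (\<integral>x. \<epsilon>' \<partial>?M)"
      proof (rule integral_mono)
        show "integrable ?M (\<lambda>x. \<bar>\<bar>u (Inl e) x\<bar> powr p - \<bar>v (Inl e) x\<bar> powr p\<bar>)"
          using i by simp
        show "integrable ?M (\<lambda>x. \<epsilon>')"
          by (intro integrable_continuous_Icc continuous_intros)
        show "\<bar>\<bar>u (Inl e) x\<bar> powr p - \<bar>v (Inl e) x\<bar> powr p\<bar> \<le> \<epsilon>'" if "x \<in> space ?M" for x
          using that close[OF e, of x] by (intro less_imp_le \<delta>(2)) (auto simp: abs_le_iff)
      qed
      also have "\<dots> = L e * \<epsilon>'"
        using L[OF e] by (intro integral_const_Icc) auto
      finally show "\<bar>(\<integral>x. \<bar>u (Inl e) x\<bar> powr p \<partial>?M) - (\<integral>x. \<bar>v (Inl e) x\<bar> powr p \<partial>?M)\<bar> \<le> L e * \<epsilon>'" .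
    qed
    also have "\<dots> = \<Lambda> * \<epsilon>'"
      by (simp add: \<Lambda>_def sum_distrib_right)
    finally show "\<bar>nonlin u - nonlin v\<bar> \<le> \<epsilon>"
      using \<epsilon>'(2) by linarith
  qed
qed

section \<open>Scaling\<close>

text \<open>
A function of mass \<open>0\<close> would vanish on the core and have nonnegative energy. Otherwise the function can be
multiplied by \<open>c \<ge> 1\<close> to obtain the prescribed mass, and \<open>E (c w) \<le> c\<^sup>2 E w \<le> E w\<close> because \<open>c\<^sup>p \<ge> c\<^sup>2\<close> and
\<open>E w < 0\<close>.
\<close>

lemma scale_to_mass:
  assumes w: "w \<in> H1 G" "graph_mass G w \<le> \<mu>" "E w < 0"
  obtains v where "v \<in> H1_mass \<mu> G" "E v \<le> E w"
proof -
  have "graph_mass G w \<noteq> 0"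
  proof
    assume "graph_mass G w = 0"
    then have "nonlin w \<le> 0"
      unfolding nonlin_def using edge_nonlin_le[OF w(1)] by (intro sum_nonpos) auto
    then have "1 / p * nonlin w \<le> 0"
      using p by (simp add: divide_nonpos_pos)
    then show False
      using w(3) graph_dirichlet_nonneg[of G w] unfolding energy_eq by linarith
  qed
  then have m: "graph_mass G w > 0"
    using graph_mass_nonneg[of G w] by simp
  define c where "c = sqrt (\<mu> / graph_mass G w)"
  have c: "c \<ge> 1" "c\<^sup>2 = \<mu> / graph_mass G w"
    using m w(2) by (auto simp: c_def)
  have "c\<^sup>2 \<le> c powr p"
    using c(1) p powr_mono[of 2 p c] by simp
  then have F: "c\<^sup>2 * nonlin w \<le> c powr p * nonlin w"
    by (intro mult_right_mono nonlin_nonneg)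
  have "E (\<lambda>e x. c * w e x) = 1 / 2 * (c\<^sup>2 * graph_dirichlet G w) - 1 / p * (c powr p * nonlin w)"
    using c(1) by (simp add: energy_eq graph_dirichlet_cmult[OF w(1)] nonlin_cmult)
  also have "\<dots> \<le> 1 / 2 * (c\<^sup>2 * graph_dirichlet G w) - 1 / p * (c\<^sup>2 * nonlin w)"
    using F p by (intro diff_left_mono mult_left_mono) auto
  also have "\<dots> = c\<^sup>2 * E w"
    by (simp add: energy_eq algebra_simps)
  also have "\<dots> \<le> 1 * E w"
    using c(1) w(3) by (intro mult_right_mono_neg) auto
  finally have "E (\<lambda>e x. c * w e x) \<le> E w"
    by simp
  moreover have "(\<lambda>e x. c * w e x) \<in> H1_mass \<mu> G"
    using m c(2) by (simp add: H1_mass_eq H1_cmult[OF w(1)] graph_mass_cmult)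
  ultimately show thesis
    using that by blast
qed

section \<open>Functions of negative energy\<close>

lemma sum_edges_G: "(\<Sum>e\<in>edges G. h e) = (\<Sum>e\<in>edges K. h (Inl e)) + (\<Sum>i<N. h (Inr i))"
proof -
  have "(\<Sum>e\<in>edges G. h e) = (\<Sum>e\<in>Inl ` edges K. h e) + (\<Sum>e\<in>Inr ` {..<N}. h e)"
    unfolding edges_G by (intro sum.union_disjoint) (auto simp: finite_edges_K)
  then show ?thesis
    by (simp add: sum.reindex)
qed

definition trial :: "real \<Rightarrow> real \<Rightarrow> 'e + nat \<Rightarrow> real \<Rightarrow> real" where
  "trial c k = case_sum (\<lambda>e x. c) (\<lambda>i x. c * exp (- k * x))"

lemma trial_Inl:
  assumes "e \<in> edges K"
  shows "trial c k (Inl e) \<in> H1_on (J (Inl e))" "dirichlet (J (Inl e)) (trial c k (Inl e)) = 0"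
    "(\<integral>x. (trial c k (Inl e) x)\<^sup>2 \<partial>lebesgue_on (J (Inl e))) = L e * c\<^sup>2"
proof -
  interpret closed_interval "J (Inl e)"
    using assms by (intro closed_interval_J) (simp add: edges_G)
  have t: "trial c k (Inl e) = (\<lambda>x. c)"
    by (simp add: trial_def)
  have sq: "sq_integrable (lebesgue_on (J (Inl e))) (\<lambda>x. b :: real)" for b
    unfolding interval_Inl[OF assms] by (intro sq_integrable_continuous_Icc continuous_intros)
  have wd: "has_weak_deriv (J (Inl e)) (\<lambda>x. c) (\<lambda>x. 0)"
    by (rule has_weak_deriv_classical) auto
  show "trial c k (Inl e) \<in> H1_on (J (Inl e))"
    unfolding t by (rule H1_onI[OF sq sq wd])
  then show "dirichlet (J (Inl e)) (trial c k (Inl e)) = 0"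
    unfolding t by (subst dirichlet_eq[OF _ _ sq wd]) auto
  show "(\<integral>x. (trial c k (Inl e) x)\<^sup>2 \<partial>lebesgue_on (J (Inl e))) = L e * c\<^sup>2"
    unfolding t interval_Inl[OF assms] using L[OF assms] by (intro integral_const_Icc) auto
qed

lemma trial_Inr:
  assumes "i < N" "k > 0"
  shows "trial c k (Inr i) \<in> H1_on (J (Inr i))" "dirichlet (J (Inr i)) (trial c k (Inr i)) = k * c\<^sup>2 / 2"
    "(\<integral>x. (trial c k (Inr i) x)\<^sup>2 \<partial>lebesgue_on (J (Inr i))) = c\<^sup>2 / (2 * k)"
proof -
  interpret closed_interval "J (Inr i)"
    using assms by (intro closed_interval_J) (simp add: edges_G)
  have t: "trial c k (Inr i) = (\<lambda>x. c * exp (- k * x))"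
    by (simp add: trial_def)
  have square: "(b * exp (- k * x))\<^sup>2 = b\<^sup>2 * exp (- (2 * k) * x)" for b x :: real
    by (simp add: power_mult_distrib flip: exp_double)
  have "2 * k > 0"
    using assms(2) by simp
  note ex = exp_decay_integral[OF this]
  have sq: "sq_integrable (lebesgue_on (J (Inr i))) (\<lambda>x. b * exp (- k * x))"
    and int: "(\<integral>x. (b * exp (- k * x))\<^sup>2 \<partial>lebesgue_on (J (Inr i))) = b\<^sup>2 / (2 * k)" for b
  proof -
    have "(\<lambda>x. b * exp (- k * x)) \<in> borel_measurable (lebesgue_on (J (Inr i)))"
      by (intro continuous_imp_measurable_on_sets_lebesgue continuous_intros) auto
    then show "sq_integrable (lebesgue_on (J (Inr i))) (\<lambda>x. b * exp (- k * x))"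
      using ex(1) unfolding sq_integrable_def square interval_Inr by simp
    show "(\<integral>x. (b * exp (- k * x))\<^sup>2 \<partial>lebesgue_on (J (Inr i))) = b\<^sup>2 / (2 * k)"
      unfolding square interval_Inr using ex(2) by simp
  qed
  have wd: "has_weak_deriv (J (Inr i)) (\<lambda>x. c * exp (- k * x)) (\<lambda>x. - k * c * exp (- k * x))"
    by (rule has_weak_deriv_classical) (auto intro!: derivative_eq_intros continuous_intros)
  show H: "trial c k (Inr i) \<in> H1_on (J (Inr i))"
    unfolding t by (rule H1_onI[OF sq sq wd])
  have "dirichlet (J (Inr i)) (trial c k (Inr i)) = (\<integral>x. (- k * c * exp (- k * x))\<^sup>2 \<partial>lebesgue_on (J (Inr i)))"
    using H unfolding t by (intro dirichlet_eq[OF _ _ sq wd] continuous_intros)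
  also have "\<dots> = (- k * c)\<^sup>2 / (2 * k)"
    by (rule int)
  also have "\<dots> = k * c\<^sup>2 / 2"
    using assms(2) by (simp add: power2_eq_square)
  finally show "dirichlet (J (Inr i)) (trial c k (Inr i)) = k * c\<^sup>2 / 2" .
  show "(\<integral>x. (trial c k (Inr i) x)\<^sup>2 \<partial>lebesgue_on (J (Inr i))) = c\<^sup>2 / (2 * k)"
    unfolding t by (rule int)
qed

lemma trial_H1:
  assumes "k > 0" shows "trial c k \<in> H1 G"
proof -
  have "trial c k e \<in> H1_on (J e)" "continuous_on (J e) (trial c k e)" if "e \<in> edges G" for e
    using that trial_Inl(1) trial_Inr(1)[OF _ assms]
    by (auto simp: edges_G trial_def intro!: continuous_intros)
  moreover have "\<forall>e\<in>edges G. trial c k e 0 = c \<and> (len G e < \<infinity> \<longrightarrow> trial c k e (real_of_ereal (len G e)) = c)"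
    by (auto simp: edges_G trial_def len_Inr)
  ultimately show ?thesis
    unfolding H1_def continuous_on_graph_def by (intro CollectI conjI ballI exI[of _ "\<lambda>_. c"]) auto
qed

text \<open>
For the trial function with value \<open>c\<close> on the core, of total length \<open>\<Lambda>\<close>, and decay rate \<open>k\<close>, the energy is
\<open>c\<^sup>2 N k / 4 - c\<^sup>p \<Lambda> / p\<close>. The rate \<open>k\<close> is chosen such that the first term is half of the second one.
Then the mass is \<open>c\<^sup>2 \<Lambda> + B c\<^sup>4\<^sup>-\<^sup>p\<close> with a constant \<open>B\<close>, and it tends to \<open>0\<close> with \<open>c\<close>, because \<open>p < 4\<close>.
\<close>

lemma negative_energy:
  assumes "edges K \<noteq> {}" "N \<ge> 1" "\<mu> > 0"
  obtains u where "u \<in> H1 G" "graph_mass G u \<le> \<mu>" "E u < 0"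
proof -
  define \<Lambda> where "\<Lambda> = (\<Sum>e\<in>edges K. L e)"
  have \<Lambda>: "\<Lambda> > 0"
    unfolding \<Lambda>_def using L assms(1) by (intro sum_pos finite_edges_K) auto
  have N: "real N > 0"
    using assms(2) by simp
  define B where "B = (real N)\<^sup>2 * p / (4 * \<Lambda>)"
  have "((\<lambda>c. c\<^sup>2 * \<Lambda> + B * c powr (4 - p)) \<longlongrightarrow> 0\<^sup>2 * \<Lambda> + B * 0) (at_right 0)"
  proof (intro tendsto_intros)
    have "eventually (\<lambda>c::real. 0 \<le> c) (at_right 0)"
      using eventually_at_right_less[of "0::real"] by eventually_elim simp
    then have "((\<lambda>c. c powr (4 - p)) \<longlongrightarrow> 0 powr (4 - p)) (at_right (0::real))"
      using p(2) by (intro tendsto_powr' tendsto_intros) auto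
    then show "((\<lambda>c. c powr (4 - p)) \<longlongrightarrow> 0) (at_right (0::real))"
      by simp
  qed
  then have "eventually (\<lambda>c. c\<^sup>2 * \<Lambda> + B * c powr (4 - p) < \<mu>) (at_right 0)"
    using assms(3) by (intro order_tendstoD(2)) auto
  then have "eventually (\<lambda>c. c\<^sup>2 * \<Lambda> + B * c powr (4 - p) < \<mu> \<and> c > 0) (at_right 0)"
    using eventually_at_right_less[of "0::real"] by eventually_elim simp
  then obtain c where c: "c\<^sup>2 * \<Lambda> + B * c powr (4 - p) < \<mu>" "c > 0"
    using eventually_happens[of _ "at_right (0::real)"] by (auto simp: trivial_limit_at_right_real)
  \<comment> \<open>The solution of \<open>c\<^sup>2 N k / 4 = c\<^sup>p \<Lambda> / (2 p)\<close>.\<close>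
  define k where "k = 2 * \<Lambda> * c powr (p - 2) / (p * N)"
  have k: "k > 0"
    using \<Lambda> c N p by (simp add: k_def)
  have c1: "c powr (4 - p) * c powr (p - 2) = c\<^sup>2"
    using c(2) by (simp flip: powr_add)
  have c2: "c powr p = c\<^sup>2 * c powr (p - 2)"
  proof -
    have "c powr p = c powr 2 * c powr (p - 2)"
      by (subst powr_add[symmetric]) simp
    then show ?thesis
      using c(2) by simp
  qed
  have "graph_mass G (trial c k) = \<Lambda> * c\<^sup>2 + N * (c\<^sup>2 / (2 * k))"
    unfolding graph_mass_def sum_edges_G
    by (simp add: trial_Inl(3) trial_Inr(3)[OF _ k] \<Lambda>_def sum_distrib_right)
  also have "N * (c\<^sup>2 / (2 * k)) = B * c powr (4 - p)"
    using k N \<Lambda> p c(2) unfolding k_def B_def c1[symmetric] by (simp add: field_simps power2_eq_square)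
  finally have mass: "graph_mass G (trial c k) \<le> \<mu>"
    using c(1) by (simp add: mult.commute)
  have "nonlin (trial c k) = (\<Sum>e\<in>edges K. L e * c powr p)"
    unfolding nonlin_def
  proof (rule sum.cong[OF refl])
    fix e assume "e \<in> edges K"
    then show "(\<integral>x. \<bar>trial c k (Inl e) x\<bar> powr p \<partial>lebesgue_on {0..L e}) = L e * c powr p"
      using L[of e] c(2) integral_const_Icc[of "L e" "c powr p"] by (simp add: trial_def)
  qed
  then have F: "nonlin (trial c k) = \<Lambda> * c powr p"
    by (simp add: \<Lambda>_def sum_distrib_right)
  have "graph_dirichlet G (trial c k) = N * (k * c\<^sup>2 / 2)"
    unfolding graph_dirichlet_def sum_edges_G by (simp add: trial_Inl(2) trial_Inr(2)[OF _ k])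
  then have "E (trial c k) = 1 / 2 * (N * (k * c\<^sup>2 / 2)) - 1 / p * (\<Lambda> * c powr p)"
    by (simp add: energy_eq F)
  also have "\<dots> = - (\<Lambda> * c powr p) / (2 * p)"
    using N p unfolding k_def c2 by (simp add: field_simps)
  also have "\<dots> < 0"
    using \<Lambda> c p by (simp add: divide_neg_pos)
  finally show thesis
    using that trial_H1[OF k] mass by blast
qed

end

section \<open>Existence of a minimizer\<close>

lemma subsequence_above:
  fixes n :: "nat \<Rightarrow> nat"
  obtains q where "strict_mono q" "\<And>k. n k \<le> q k"
proof (rule that[of "\<lambda>k. (\<Sum>i\<le>k. n i) + k"])
  show "strict_mono (\<lambda>k. (\<Sum>i\<le>k. n i) + k)"
    by (rule strict_monoI_Suc) simp
  show "n k \<le> (\<Sum>i\<le>k. n i) + k" for k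
    using member_le_sum[of k "{..k}" n] by simp
qed

context half_line_graph
begin

text \<open>
If \<open>u n\<close> and \<open>u k\<close> almost minimize the energy and are uniformly close on the core, then their midpoint
cannot have a much smaller Dirichlet integral than they have, since its energy is at least \<open>I\<close>. By the
parallelogram identity their derivatives are then close in \<open>L\<^sup>2\<close>.
\<close>

lemma minimizing_sequence_dirichlet_Cauchy:
  fixes u :: "nat \<Rightarrow> 'e + nat \<Rightarrow> real \<Rightarrow> real" and I :: real
  assumes u: "\<And>n. u n \<in> H1 G" and m: "\<And>n. graph_mass G (u n) \<le> \<mu>"
    and lower: "\<And>w. w \<in> H1 G \<Longrightarrow> graph_mass G w \<le> \<mu> \<Longrightarrow> I \<le> E w"
    and min: "(\<lambda>n. E (u n)) \<longlonglongrightarrow> I"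
    and M: "\<And>n e x. e \<in> edges K \<Longrightarrow> x \<in> {0..L e} \<Longrightarrow> \<bar>u n (Inl e) x\<bar> \<le> M"
    and g: "\<And>e. e \<in> edges K \<Longrightarrow> uniform_limit {0..L e} (\<lambda>n. u n (Inl e)) (g e) sequentially"
    and \<epsilon>: "\<epsilon> > 0"
  shows "\<exists>n0. \<forall>n\<ge>n0. \<forall>m\<ge>n0. graph_dirichlet G (\<lambda>e x. u n e x - u m e x) \<le> \<epsilon>"
proof -
  \<comment> \<open>The two energies and the two values of the nonlinear term account for \<open>\<epsilon> / 16\<close> each in a
    bound for \<open>D (u n - u k) / 4\<close>.\<close>
  have "p * \<epsilon> / 16 > 0"
    using p \<epsilon> by simp
  then obtain \<delta> where \<delta>: "\<delta> > 0" "\<And>v w. v \<in> H1 G \<Longrightarrow> w \<in> H1 G \<Longrightarrow>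
    (\<And>e x. e \<in> edges K \<Longrightarrow> x \<in> {0..L e} \<Longrightarrow> \<bar>v (Inl e) x\<bar> \<le> M \<and> \<bar>w (Inl e) x\<bar> \<le> M \<and> \<bar>v (Inl e) x - w (Inl e) x\<bar> < \<delta>) \<Longrightarrow>
    \<bar>nonlin v - nonlin w\<bar> \<le> p * \<epsilon> / 16"
    by (rule nonlin_uniformly_continuous[where M = M]) blast
  have "eventually (\<lambda>n. \<forall>e\<in>edges K. \<forall>x\<in>{0..L e}. dist (u n (Inl e) x) (g e x) < \<delta>) sequentially"
    by (rule eventually_ball_finite[OF finite_edges_K]) (use g \<delta>(1) in \<open>auto simp: uniform_limit_iff\<close>)
  moreover have "eventually (\<lambda>n. E (u n) < I + \<epsilon> / 16) sequentially"
    using min \<epsilon> by (intro order_tendstoD(2)) auto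
  ultimately have "eventually (\<lambda>n. (\<forall>e\<in>edges K. \<forall>x\<in>{0..L e}. dist (u n (Inl e) x) (g e x) < \<delta>) \<and> E (u n) < I + \<epsilon> / 16) sequentially"
    by (rule eventually_conj)
  then obtain n0 where n0: "\<And>n e x. n \<ge> n0 \<Longrightarrow> e \<in> edges K \<Longrightarrow> x \<in> {0..L e} \<Longrightarrow> dist (u n (Inl e) x) (g e x) < \<delta>"
    "\<And>n. n \<ge> n0 \<Longrightarrow> E (u n) < I + \<epsilon> / 16"
    unfolding eventually_sequentially by blast
  have "graph_dirichlet G (\<lambda>e x. u n e x - u k e x) \<le> \<epsilon>" if nk: "n \<ge> n0" "k \<ge> n0" for n k
  proof -
    define w where "w = (\<lambda>e x. 1/2 * u n e x + 1/2 * u k e x)"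
    have w: "w \<in> H1 G"
      unfolding w_def by (intro H1_lincomb u)
    have "graph_mass G w \<le> \<mu>"
      using graph_mass_midpoint[OF u[of n] u[of k]] m[of n] m[of k] by (simp add: w_def)
    with w have Ew: "I \<le> E w"
      by (rule lower)
    have close: "\<bar>u n (Inl e) x\<bar> \<le> M \<and> \<bar>u k (Inl e) x\<bar> \<le> M \<and> \<bar>w (Inl e) x\<bar> \<le> M \<and>
        \<bar>u n (Inl e) x - w (Inl e) x\<bar> < \<delta> \<and> \<bar>u k (Inl e) x - w (Inl e) x\<bar> < \<delta>"
      if "e \<in> edges K" "x \<in> {0..L e}" for e x
    proof -
      have "\<bar>u n (Inl e) x - g e x\<bar> < \<delta>" "\<bar>u k (Inl e) x - g e x\<bar> < \<delta>"
        using n0(1)[OF nk(1) that] n0(1)[OF nk(2) that] by (simp_all only: dist_real_def)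
      moreover have "\<bar>u n (Inl e) x\<bar> \<le> M" "\<bar>u k (Inl e) x\<bar> \<le> M"
        by (intro M that)+
      moreover have "2 * w (Inl e) x = u n (Inl e) x + u k (Inl e) x"
        by (simp add: w_def)
      ultimately show ?thesis
        by (intro conjI) linarith+
    qed
    have "\<bar>nonlin (u n) - nonlin w\<bar> \<le> p * \<epsilon> / 16" "\<bar>nonlin (u k) - nonlin w\<bar> \<le> p * \<epsilon> / 16"
      using close by (intro \<delta>(2) u w; blast)+
    then have "nonlin (u n) + nonlin (u k) - 2 * nonlin w \<le> p * \<epsilon> / 16 + p * \<epsilon> / 16"
      by linarith
    also have "\<dots> = p * (\<epsilon> / 8)"
      by simp
    finally have "nonlin (u n) + nonlin (u k) - 2 * nonlin w \<le> p * (\<epsilon> / 8)" .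
    then have "1 / p * (nonlin (u n) + nonlin (u k) - 2 * nonlin w) \<le> 1 / p * (p * (\<epsilon> / 8))"
      using p by (intro mult_left_mono) auto
    then have F: "1 / p * (nonlin (u n) + nonlin (u k) - 2 * nonlin w) \<le> \<epsilon> / 8"
      using p by simp
    have "1/4 * graph_dirichlet G (\<lambda>e x. u n e x - u k e x) =
        E (u n) + E (u k) - 2 * E w + 1 / p * (nonlin (u n) + nonlin (u k) - 2 * nonlin w)"
      using graph_dirichlet_parallelogram[OF u[of n] u[of k]]
      unfolding w_def[symmetric] energy_eq by (simp add: algebra_simps add_divide_distrib diff_divide_distrib)
    then show ?thesis
      using n0(2)[OF nk(1)] n0(2)[OF nk(2)] Ew F by linarith
  qed
  then show ?thesis
    by blast
qed

lemma nonlin_tendsto: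
  assumes u: "\<And>n. u n \<in> H1 G" and w: "w \<in> H1 G"
    and lim: "\<And>e x. e \<in> edges G \<Longrightarrow> x \<in> J e \<Longrightarrow> (\<lambda>n. u n e x) \<longlonglongrightarrow> w e x"
    and M: "\<And>n e x. e \<in> edges K \<Longrightarrow> x \<in> {0..L e} \<Longrightarrow> \<bar>u n (Inl e) x\<bar> \<le> M"
  shows "(\<lambda>n. nonlin (u n)) \<longlonglongrightarrow> nonlin w"
  unfolding nonlin_def
proof (rule tendsto_sum)
  fix e assume e: "e \<in> edges K"
  let ?M = "lebesgue_on {0..L e}"
  have meas: "(\<lambda>x. \<bar>v (Inl e) x\<bar> powr p) \<in> borel_measurable ?M" if "v \<in> H1 G" for v
    using p by (intro borel_measurable_integrable integrable_continuous_Icc continuous_on_abs_powr continuous_Inl that e) auto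
  show "(\<lambda>n. \<integral>x. \<bar>u n (Inl e) x\<bar> powr p \<partial>?M) \<longlonglongrightarrow> (\<integral>x. \<bar>w (Inl e) x\<bar> powr p \<partial>?M)"
  proof (rule integral_dominated_convergence[where w = "\<lambda>_. M powr p"])
    show "integrable ?M (\<lambda>_. M powr p)"
      by (intro integrable_continuous_Icc continuous_intros)
    show "AE x in ?M. norm (\<bar>u n (Inl e) x\<bar> powr p) \<le> M powr p" for n
      using M[OF e, of _ n] p by (intro AE_I2) (auto intro!: powr_mono2)
    show "AE x in ?M. (\<lambda>n. \<bar>u n (Inl e) x\<bar> powr p) \<longlonglongrightarrow> \<bar>w (Inl e) x\<bar> powr p"
    proof (intro AE_I2)
      fix x assume "x \<in> space ?M"
      then have "(\<lambda>n. u n (Inl e) x) \<longlonglongrightarrow> w (Inl e) x"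
        using e by (intro lim) (auto simp: edges_G interval_Inl)
      then show "(\<lambda>n. \<bar>u n (Inl e) x\<bar> powr p) \<longlonglongrightarrow> \<bar>w (Inl e) x\<bar> powr p"
        using p by (intro tendsto_powr' tendsto_rabs tendsto_const) auto
    qed
  qed (intro meas u w)+
qed

text \<open>
A minimizing sequence is refined twice: to converge uniformly on the core, and then to make its derivatives
rapidly Cauchy.
\<close>

lemma minimizer_exists:
  assumes "edges K \<noteq> {}" "N \<ge> 1" and \<mu>: "\<mu> > 0"
  shows "\<exists>u\<in>H1_mass \<mu> G. \<forall>v\<in>H1_mass \<mu> G. E u \<le> E v"
proof -
  obtain C where C: "\<And>u. u \<in> H1 G \<Longrightarrow> graph_mass G u \<le> \<mu> \<Longrightarrow> graph_dirichlet G u \<le> 4 * E u + C"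
    using coercive[OF \<mu>] by blast
  obtain v0 where v0: "v0 \<in> H1_mass \<mu> G" "E v0 < 0"
  proof -
    obtain u where u: "u \<in> H1 G" "graph_mass G u \<le> \<mu>" "E u < 0"
      using negative_energy[OF assms] by blast
    obtain v where v: "v \<in> H1_mass \<mu> G" "E v \<le> E u"
      using scale_to_mass[OF u] by blast
    show thesis
      by (rule that[OF v(1) le_less_trans[OF v(2) u(3)]])
  qed
  define I where "I = (INF u\<in>H1_mass \<mu> G. E u)"
  have bdd: "bdd_below (E ` H1_mass \<mu> G)"
  proof (rule bdd_belowI2)
    fix u assume "u \<in> H1_mass \<mu> G"
    then have "0 \<le> 4 * E u + C"
      using C[of u] graph_dirichlet_nonneg[of G u] by (auto simp: H1_mass_eq)
    then show "- C / 4 \<le> E u"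
      by simp
  qed
  have I_le: "I \<le> E u" if "u \<in> H1_mass \<mu> G" for u
    unfolding I_def using bdd that by (rule cINF_lower)
  have "I < 0"
    using I_le[OF v0(1)] v0(2) by linarith
  have lower: "I \<le> E w" if w: "w \<in> H1 G" "graph_mass G w \<le> \<mu>" for w
  proof (cases "E w < 0")
    case True
    obtain v where v: "v \<in> H1_mass \<mu> G" "E v \<le> E w"
      using scale_to_mass[OF w True] by blast
    show ?thesis
      by (rule order_trans[OF I_le[OF v(1)] v(2)])
  qed (use \<open>I < 0\<close> in linarith)
  have "\<exists>u\<in>H1_mass \<mu> G. E u < I + 1 / real (Suc n)" for n
    using cInf_lessD[of "E ` H1_mass \<mu> G" "I + 1 / real (Suc n)"] v0(1) by (auto simp: I_def)
  then have "\<forall>n. \<exists>u. u \<in> H1_mass \<mu> G \<and> E u < I + 1 / real (Suc n)"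
    by blast
  from choice[OF this] obtain v where v: "\<And>n. v n \<in> H1_mass \<mu> G" "\<And>n. E (v n) < I + 1 / real (Suc n)"
    by blast
  have vH: "v n \<in> H1 G" "graph_mass G (v n) \<le> \<mu>" for n
    using v(1)[of n] by (auto simp: H1_mass_eq)
  have v_lim: "(\<lambda>n. E (v n)) \<longlonglongrightarrow> I"
  proof (rule tendsto_sandwich[of "\<lambda>_. I" _ _ "\<lambda>n. I + 1 / real (Suc n)"])
    show "(\<lambda>n. I + 1 / real (Suc n)) \<longlonglongrightarrow> I"
      using tendsto_add[OF tendsto_const LIMSEQ_Suc[OF lim_1_over_n], of I] by simp
    show "eventually (\<lambda>n. E (v n) \<le> I + 1 / real (Suc n)) sequentially"
      by (intro always_eventually allI less_imp_le v(2))
    show "eventually (\<lambda>n. I \<le> E (v n)) sequentially"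
      by (intro always_eventually allI I_le v(1))
  qed simp
  define D where "D = 4 * (I + 1) + C"
  have D: "graph_dirichlet G (v n) \<le> D" for n
  proof -
    have "E (v n) < I + 1"
      by (rule less_le_trans[OF v(2)[of n]]) simp
    then show ?thesis
      unfolding D_def by (intro order_trans[OF C[OF vH]] add_right_mono mult_left_mono) auto
  qed
  obtain r :: "nat \<Rightarrow> nat" where r: "strict_mono r"
    and "\<forall>e\<in>edges G. \<exists>g. uniform_limit {0..segment_length G e} (\<lambda>n. v (r n) e) g sequentially"
    using H1_compactness[of v, OF vH(1) D vH(2)] by blast
  from bchoice[OF this(2)] obtain g where
    g: "\<And>e. e \<in> edges G \<Longrightarrow> uniform_limit {0..segment_length G e} (\<lambda>n. v (r n) e) (g e) sequentially"
    by blast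
  define u where "u n = v (r n)" for n
  define M where "M = (\<Sum>e\<in>edges K. sqrt (2 / L e * \<mu> + 2 * L e * D))"
  have M: "\<bar>u n (Inl e) x\<bar> \<le> M" if e: "e \<in> edges K" and x: "x \<in> {0..L e}" for n e x
  proof -
    have D0: "D \<ge> 0"
      using D[of 0] graph_dirichlet_nonneg[of G "v 0"] by linarith
    have "(u n (Inl e) x)\<^sup>2 \<le> 2 / L e * graph_mass G (u n) + 2 * L e * graph_dirichlet G (u n)"
      unfolding u_def by (intro sup_bound_Inl vH e x)
    also have "\<dots> \<le> 2 / L e * \<mu> + 2 * L e * D"
      using L[OF e] unfolding u_def by (intro add_mono mult_left_mono vH D) auto
    finally have "\<bar>u n (Inl e) x\<bar> \<le> sqrt (2 / L e * \<mu> + 2 * L e * D)"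
      by (intro real_le_rsqrt) simp
    also have "\<dots> \<le> M"
      unfolding M_def
    proof (rule member_le_sum[OF e _ finite_edges_K])
      fix a assume "a \<in> edges K - {e}"
      then show "0 \<le> sqrt (2 / L a * \<mu> + 2 * L a * D)"
        using L[of a] \<mu> D0 by auto
    qed
    finally show ?thesis .
  qed
  have u_lim: "(\<lambda>n. E (u n)) \<longlonglongrightarrow> I"
    unfolding u_def using LIMSEQ_subseq_LIMSEQ[OF v_lim r] by (simp add: o_def)
  have "\<exists>n0. \<forall>n\<ge>n0. \<forall>m\<ge>n0. graph_dirichlet G (\<lambda>e x. u n e x - u m e x) \<le> (1/4) ^ k" for k :: nat
  proof (rule minimizing_sequence_dirichlet_Cauchy[where I = I and \<mu> = \<mu> and M = M and g = "\<lambda>e. g (Inl e)"])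
    show "uniform_limit {0..L e} (\<lambda>n. u n (Inl e)) (g (Inl e)) sequentially" if "e \<in> edges K" for e
      using g[of "Inl e"] that by (simp add: u_def edges_G segment_length_Inl)
  qed (use vH M u_lim lower in \<open>auto simp: u_def\<close>)
  then obtain n0 where n0: "\<And>k n m. n \<ge> n0 k \<Longrightarrow> m \<ge> n0 k \<Longrightarrow>
      graph_dirichlet G (\<lambda>e x. u n e x - u m e x) \<le> (1/4) ^ k"
    by metis
  obtain q where q: "strict_mono q" "\<And>k. n0 k \<le> q k"
    using subsequence_above[of n0] by blast
  have uq: "u (q n) \<in> H1 G" "graph_mass G (u (q n)) \<le> \<mu>" for n
    by (auto simp: u_def vH)
  have rapid: "graph_dirichlet G (\<lambda>e x. u (q k) e x - u (q n) e x) \<le> (1/4) ^ n" if "n \<le> k" for n k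
    using n0[of n "q k" "q n"] q(2)[of n] strict_mono_less_eq[OF q(1), of n k] that by simp
  have start: "convergent (\<lambda>n. u (q n) e 0)" if e: "e \<in> edges G" for e
  proof -
    have "(\<lambda>n. u n e 0) \<longlonglongrightarrow> g e 0"
      unfolding u_def by (rule tendsto_uniform_limitI[OF g[OF e]]) (use segment_length(1)[OF e] in simp)
    from LIMSEQ_subseq_LIMSEQ[OF this q(1)] show ?thesis
      by (auto simp: o_def intro: convergentI)
  qed
  obtain w where w: "w \<in> H1 G" "\<And>e x. e \<in> edges G \<Longrightarrow> x \<in> J e \<Longrightarrow> (\<lambda>n. u (q n) e x) \<longlonglongrightarrow> w e x"
    "(\<lambda>n. graph_dirichlet G (u (q n))) \<longlonglongrightarrow> graph_dirichlet G w" "graph_mass G w \<le> \<mu>"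
    by (rule H1_limit[OF uq rapid start]) blast+
  have "(\<lambda>n. nonlin (u (q n))) \<longlonglongrightarrow> nonlin w"
    by (rule nonlin_tendsto[OF uq(1) w(1,2) M])
  then have "(\<lambda>n. E (u (q n))) \<longlonglongrightarrow> E w"
    unfolding energy_eq by (intro tendsto_intros w(3))
  moreover have "(\<lambda>n. E (u (q n))) \<longlonglongrightarrow> I"
    using LIMSEQ_subseq_LIMSEQ[OF u_lim q(1)] by (simp add: o_def)
  ultimately have "E w = I"
    by (rule LIMSEQ_unique)
  then have "E w < 0"
    using \<open>I < 0\<close> by simp
  then obtain u' where u': "u' \<in> H1_mass \<mu> G" "E u' \<le> E w"
    using scale_to_mass[OF w(1,4)] by blast
  have "E u' \<le> E v" if "v \<in> H1_mass \<mu> G" for v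
    using u'(2) I_le[OF that] \<open>E w = I\<close> by simp
  with u'(1) show ?thesis
    by blast
qed

end

theorem theorem3p3:
  fixes K :: "('v, 'e) metric_graph" and N :: nat and s :: "nat \<Rightarrow> 'v" and \<mu> p :: real
  assumes "compact_metric_graph K" and "edges K \<noteq> {}"
    and "N \<ge> 1" and "\<And>i. i < N \<Longrightarrow> s i \<in> verts (graph K)"
    and "\<mu> > 0" and "2 < p" and "p < 4"
  defines "G \<equiv> attach_half_lines K N s"
  shows "\<exists>u\<in>H1_mass \<mu> G. ereal (energy p K N s u) = (INF v\<in>H1_mass \<mu> G. ereal (energy p K N s v))"
proof -
  interpret half_line_graph K N s p
    using assms(1,6,7) by unfold_locales
  obtain u where u: "u \<in> H1_mass \<mu> G" "\<And>v. v \<in> H1_mass \<mu> G \<Longrightarrow> energy p K N s u \<le> energy p K N s v"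
    using minimizer_exists[OF assms(2,3,5)] unfolding G_def by blast
  then have "ereal (energy p K N s u) = (INF v\<in>H1_mass \<mu> G. ereal (energy p K N s v))"
    by (intro antisym INF_greatest INF_lower) auto
  with u(1) show ?thesis
    by blast
qed

end
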